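(* Work in one of the following two situations. In Situation $\mathfrak{m}$: put $\mathfrak{B}_v=\mathfrak{m}_v$ for $v\in \mathrm{S}(K)$ and equip $\mathrm{S}(K)$ with the topology $\mathcal{T}_{\mathrm{Zar}^*}$. In Situation $\mathcal{O}$: put $\mathfrak{B}_v=\mathcal{O}_v$ for $v\in \mathrm{S}(K)$ and equip $\mathrm{S}(K)$ with the Zariski topology $\mathcal{T}_{\mathrm{Zar}}$. Let $K$ be a field, $S_1,\dots,S_n\subseteq \mathrm{S}(K)$, $t\in K^\times$, $x_1,\dots,x_n\in K$ and $z_1,\dots,z_n\in K^\times$. Assume: (U) the uniformity assumption (defined in the context) holds for $S=S_1\cup\dots\cup S_n$ and $t$; (T) each $S_i$ is compact in the given topology; (I) for any $i,j$ and any valuation $w$ on $K$ with a refinement in $S_i$ and a refinement in $S_j$ we have $w(x_i-x_j)\geq w(z_i)=w(z_j)$; further, the sets $S_i$ are pairwise $t$-independent, and in Situation $\mathfrak{m}$ they are furthermore pairwise incomparable. Then (in either situation) there exists $x\in K$ with $$x-x_i\in z_i\mathfrak{B}_v\quad\text{for all } v\in S_i,\ \text{for } i=1,\dots,n.$$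
   Context: Localities. For a field $K$, $\mathrm{S}_{\mathrm{val}}(K)$ is the set of equivalence classes of Krull valuations (written additively, trivial one included), $\mathrm{S}_{\mathrm{ord}}(K)$ the set of orderings, $\mathrm{S}_{\mathrm{abs}}(K)$ the set of equivalence classes of absolute values. $\mathrm{S}(K)$ is their union, with rank-1 valuations and archimedean orderings identified with the associated absolute values (and the trivial absolute value with the trivial valuation); its elements are called localities. For $v\in\mathrm{S}(K)$: $\mathcal{O}_v=\{v(x)\ge0\}$, $\{-1\le_v x\le_v 1\}$, $\{|x|_v\le 1\}$ and $\mathfrak{m}_v=\{v(x)>0\}$, $\{-1<_v x<_v 1\}$, $\{|x|_v<1\}$ (subsets of $K$), according to whether $v$ is a valuation, ordering, or absolute value; $\mathcal{O}_v^\times=\mathcal{O}_v\setminus\mathfrak{m}_v$. A locality $v$ is determined by $\mathcal{O}_v$. Topologies on $\mathrm{S}(K)$: $\mathcal{T}_{\mathrm{Zar}}$ has open subbasis $\{v: x\in\mathcal{O}_v\}$, $x\in K$; $\mathcal{T}_{\mathrm{Zar}^*}$ has open subbasis $\{v: x\in\mathfrak{m}_v\}$, $x\in K$. Compact means quasi-compact. Order: if $\mathcal{O}_v\subseteq\mathcal{O}_w$, then $v$ is a refinement of $w$ and $w$ a coarsening of $v$ (equality allowed). Incomparable means neither refines the other. $v\vee w$ denotes the finest common coarsening of $v,w$ in $\mathrm{S}(K)$ (it exists). If a valuation $w$ coarsens $v$, then $v$ induces a locality $\bar v\in\mathrm{S}(Kw)$ on the residue field $Kw$ ($\mathcal{O}_{\bar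 v}$ is the image of $\mathcal{O}_v$). Localities $v,w$ are strongly incomparable if they are incomparable and induce distinct localities on the residue field of $v\vee w$. For $t\in K^\times$, $v,w$ are $t$-independent if $t\in\mathcal{O}_{v\vee w}^\times$ and, additionally, $v,w$ are strongly incomparable in case both are orderings. Two sets of localities are incomparable (resp. $t$-independent) if every element of the first is incomparable (resp. $t$-independent) to every element of the second. Uniformity assumption for $S\subseteq\mathrm{S}(K)$ and $t\in K^\times$: there exists a polynomial $f\in K[X]$ of degree $d\ge2$ with leading coefficient $a_d$ such that for all $v\in S$: (i) for any $x\in\mathcal{O}_v$, $f(x)\in\mathcal{O}_v$; (ii) for any $x\in\mathcal{O}_v$, $f(x)\notin t\mathfrak{m}_v$; (iii) for any $x\in K\setminus\mathcal{O}_v$, $f(x)\in x^d(\mathcal{O}_v\setminus t\mathfrak{m}_v)\cap(a_dx^d+x^{d-1}\mathcal{O}_v)$; (iv) $\mathcal{O}_v+\mathcal{O}_v\subseteq t^{-1}\mathcal{O}_v$. *)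

theory Defs
  imports
    "HOL-Analysis.Abstract_Topology"
    "HOL-Algebra.Group"
    "HOL-Library.Set_Algebras"
    "HOL-Computational_Algebra.Polynomial"
begin

text \<open>
  The value group is a structure with an explicit carrier, because value groups are quantified
  over below. It is written multiplicatively, as HOL-Algebra does, although valuations are read
  additively: \<open>None\<close> is the value \<open>\<infinity>\<close>, the largest one, and \<open>\<one>\<close> is the value \<open>0\<close>.
\<close>

record ('a, 'g) valuation =
  vgroup :: "'g monoid"
  vorder :: "('g \<times> 'g) set"
  val :: "'a \<Rightarrow> 'g option"

definition ordered_comm_group :: "'g monoid \<Rightarrow> ('g \<times> 'g) set \<Rightarrow> bool" where
  "ordered_comm_group G r \<longleftrightarrow> comm_group G \<and> linear_order_on (carrier G) r \<and>
     (\<forall>a b c. (a, b) \<in> r \<and> c \<in> carrier G \<longrightarrow> (a \<otimes>\<^bsub>G\<^esub> c, b \<otimes>\<^bsub>G\<^esub> c) \<in> r)"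

definition ext_plus :: "'g monoid \<Rightarrow> 'g option \<Rightarrow> 'g option \<Rightarrow> 'g option" where
  "ext_plus G a b =
     (case a of None \<Rightarrow> None
      | Some g \<Rightarrow> (case b of None \<Rightarrow> None | Some h \<Rightarrow> Some (g \<otimes>\<^bsub>G\<^esub> h)))"

definition ext_le :: "('g \<times> 'g) set \<Rightarrow> 'g option \<Rightarrow> 'g option \<Rightarrow> bool" where
  "ext_le r a b \<longleftrightarrow>
     (case b of None \<Rightarrow> True
      | Some h \<Rightarrow> (case a of None \<Rightarrow> False | Some g \<Rightarrow> (g, h) \<in> r))"

text \<open>
  The last clause is \<open>min (v x) (v y) \<le> v (x + y)\<close>. The value map need not be onto the
  value group.
\<close>

definition krull_valuation :: "('a::field, 'g) valuation \<Rightarrow> bool" where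
  "krull_valuation w \<longleftrightarrow>
     ordered_comm_group (vgroup w) (vorder w) \<and>
     (\<forall>x g. val w x = Some g \<longrightarrow> g \<in> carrier (vgroup w)) \<and>
     (\<forall>x. val w x = None \<longleftrightarrow> x = 0) \<and>
     (\<forall>x y. val w (x * y) = ext_plus (vgroup w) (val w x) (val w y)) \<and>
     (\<forall>x y. ext_le (vorder w) (val w x) (val w (x + y)) \<or>
            ext_le (vorder w) (val w y) (val w (x + y)))"

definition val_le :: "('a, 'g) valuation \<Rightarrow> 'a \<Rightarrow> 'a \<Rightarrow> bool" where
  "val_le w x y \<longleftrightarrow> ext_le (vorder w) (val w x) (val w y)"

text \<open>A field ordering is given by the relation of all pairs \<open>(x, y)\<close> with \<open>x \<le> y\<close>.\<close>

definition field_ordering :: "('a::field \<times> 'a) set \<Rightarrow> bool" where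
  "field_ordering r \<longleftrightarrow> linear_order_on UNIV r \<and>
     (\<forall>x y z. (x, y) \<in> r \<longrightarrow> (x + z, y + z) \<in> r) \<and>
     (\<forall>x y. (0, x) \<in> r \<and> (0, y) \<in> r \<longrightarrow> (0, x * y) \<in> r)"

definition absolute_value :: "('a::field \<Rightarrow> real) \<Rightarrow> bool" where
  "absolute_value f \<longleftrightarrow>
     (\<forall>x. 0 \<le> f x) \<and> (\<forall>x. f x = 0 \<longleftrightarrow> x = 0) \<and>
     (\<forall>x y. f (x * y) = f x * f y) \<and> (\<forall>x y. f (x + y) \<le> f x + f y)"

text \<open>
  A locality is represented by the pair of its sets \<open>\<O>\<^sub>v\<close> and \<open>\<mm>\<^sub>v\<close>, written \<open>Oset v\<close> and
  \<open>Mset v\<close>. Since a locality is determined by \<open>\<O>\<^sub>v\<close>, passing to this pair is the same as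
  passing to equivalence classes of valuations and of absolute values and identifying rank-1
  valuations and archimedean orderings with the associated absolute values. That \<open>Oset\<close> alone
  determines the pair is lemma \<open>locality_eqI\<close>.
\<close>

datatype 'a locality = Locality (Oset: "'a set") (Mset: "'a set")

definition locality_of_val :: "('a::field, 'g) valuation \<Rightarrow> 'a locality" where
  "locality_of_val w = Locality
     {x. ext_le (vorder w) (Some \<one>\<^bsub>vgroup w\<^esub>) (val w x)}
     {x. ext_le (vorder w) (Some \<one>\<^bsub>vgroup w\<^esub>) (val w x) \<and> val w x \<noteq> Some \<one>\<^bsub>vgroup w\<^esub>}"

definition locality_of_ord :: "('a::field \<times> 'a) set \<Rightarrow> 'a locality" where
  "locality_of_ord r = Locality
     {x. (- 1, x) \<in> r \<and> (x, 1) \<in> r}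
     {x. (- 1, x) \<in> r \<and> x \<noteq> - 1 \<and> (x, 1) \<in> r \<and> x \<noteq> 1}"

definition locality_of_abs :: "('a::field \<Rightarrow> real) \<Rightarrow> 'a locality" where
  "locality_of_abs f = Locality {x. f x \<le> 1} {x. f x < 1}"

text \<open>
  Value groups are taken to have elements in \<open>'a set\<close>. This loses no equivalence class of
  valuations: see \<open>krull_valuation_transfer\<close> and \<open>locality_of_val_transfer\<close>.
\<close>

definition val_localities :: "'a::field locality set" where
  "val_localities = {locality_of_val w | w :: ('a, 'a set) valuation. krull_valuation w}"

definition ord_localities :: "'a::field locality set" where
  "ord_localities = {locality_of_ord r | r. field_ordering r}"

definition abs_localities :: "'a::field locality set" where
  "abs_localities = {locality_of_abs f | f. absolute_value f}"

definition localities :: "'a::field locality set" where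
  "localities = val_localities \<union> ord_localities \<union> abs_localities"

definition Ounits :: "'a locality \<Rightarrow> 'a set" where
  "Ounits v = Oset v - Mset v"

definition zariski :: "'a::field locality topology" where
  "zariski = topology_generated_by (range (\<lambda>x. {v \<in> localities. x \<in> Oset v}))"

definition zariski_star :: "'a::field locality topology" where
  "zariski_star = topology_generated_by (range (\<lambda>x. {v \<in> localities. x \<in> Mset v}))"

text \<open>\<open>refines v w\<close>: \<open>v\<close> is a refinement of \<open>w\<close>, and \<open>w\<close> is a coarsening of \<open>v\<close>.\<close>

definition refines :: "'a locality \<Rightarrow> 'a locality \<Rightarrow> bool" where
  "refines v w \<longleftrightarrow> Oset v \<subseteq> Oset w"

definition incomparable :: "'a locality \<Rightarrow> 'a locality \<Rightarrow> bool" where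
  "incomparable v w \<longleftrightarrow> \<not> refines v w \<and> \<not> refines w v"

definition finest_common_coarsening ::
    "'a::field locality \<Rightarrow> 'a locality \<Rightarrow> 'a locality \<Rightarrow> bool" where
  "finest_common_coarsening v w u \<longleftrightarrow>
     u \<in> localities \<and> refines v u \<and> refines w u \<and>
     (\<forall>u' \<in> localities. refines v u' \<and> refines w u' \<longrightarrow> refines u u')"

definition join :: "'a::field locality \<Rightarrow> 'a locality \<Rightarrow> 'a locality" where
  "join v w = (THE u. finest_common_coarsening v w u)"

text \<open>
  For a valuation \<open>u\<close> coarsening \<open>v\<close>, the locality that \<open>v\<close> induces on the residue field
  \<open>\<O>\<^sub>u / \<mm>\<^sub>u\<close> is given by its set \<open>\<O>\<close>, the image of \<open>\<O>\<^sub>v\<close> under \<open>x \<mapsto> x + \<mm>\<^sub>u\<close>.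
\<close>

definition residue_Oset :: "'a::field locality \<Rightarrow> 'a locality \<Rightarrow> 'a set set" where
  "residue_Oset u v = (\<lambda>x. x +o Mset u) ` Oset v"

text \<open>
  If \<open>v\<close> and \<open>w\<close> are incomparable, then \<open>join v w\<close> is a valuation: orderings and
  archimedean absolute values have no proper refinements.
\<close>

definition strongly_incomparable :: "'a::field locality \<Rightarrow> 'a locality \<Rightarrow> bool" where
  "strongly_incomparable v w \<longleftrightarrow>
     incomparable v w \<and> residue_Oset (join v w) v \<noteq> residue_Oset (join v w) w"

definition independent_at :: "'a::field \<Rightarrow> 'a locality \<Rightarrow> 'a locality \<Rightarrow> bool" where
  "independent_at t v w \<longleftrightarrow>
     t \<in> Ounits (join v w) \<and>
     (v \<in> ord_localities \<and> w \<in> ord_localities \<longrightarrow> strongly_incomparable v w)"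

definition uniformity_assumption :: "'a::field locality set \<Rightarrow> 'a \<Rightarrow> bool" where
  "uniformity_assumption S t \<longleftrightarrow>
     (\<exists>f :: 'a poly. degree f \<ge> 2 \<and>
       (\<forall>v \<in> S.
          (\<forall>x \<in> Oset v. poly f x \<in> Oset v) \<and>
          (\<forall>x \<in> Oset v. poly f x \<notin> t *o Mset v) \<and>
          (\<forall>x \<in> - Oset v.
             poly f x \<in> (x ^ degree f) *o (Oset v - t *o Mset v) \<inter>
               ((lead_coeff f * x ^ degree f) +o ((x ^ (degree f - 1)) *o Oset v))) \<and>
          Oset v + Oset v \<subseteq> inverse t *o Oset v))"

datatype situation = Sit_m | Sit_O

fun sit_set :: "situation \<Rightarrow> 'a locality \<Rightarrow> 'a set" where
  "sit_set Sit_m v = Mset v"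
| "sit_set Sit_O v = Oset v"

fun sit_topology :: "situation \<Rightarrow> 'a::field locality topology" where
  "sit_topology Sit_m = zariski_star"
| "sit_topology Sit_O = zariski"

lemma krull_valuation_transfer:
  fixes w :: "('a::field, 'g) valuation"
  assumes w: "krull_valuation w"
  shows "\<exists>w' :: ('a, 'a set) valuation. krull_valuation w' \<and>
           (\<forall>x y. val_le w' x y \<longleftrightarrow> val_le w x y)"
proof -
  define G where "G = vgroup w"
  define r where "r = vorder w"
  interpret comm_group G
    using w by (simp add: krull_valuation_def ordered_comm_group_def G_def)
  have lin: "linear_order_on (carrier G) r"
    and mono: "\<And>a b c. (a, b) \<in> r \<Longrightarrow> c \<in> carrier G \<Longrightarrow> (a \<otimes>\<^bsub>G\<^esub> c, b \<otimes>\<^bsub>G\<^esub> c) \<in> r"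
    and cl: "\<And>x g. val w x = Some g \<Longrightarrow> g \<in> carrier G"
    and zero: "\<And>x. val w x = None \<longleftrightarrow> x = 0"
    and mul: "\<And>x y. val w (x * y) = ext_plus G (val w x) (val w y)"
    and add: "\<And>x y. ext_le r (val w x) (val w (x + y)) \<or> ext_le r (val w y) (val w (x + y))"
    using w by (auto simp: krull_valuation_def ordered_comm_group_def G_def r_def)
  define H where "H = {g. \<exists>x. val w x = Some g}"
  define \<phi> where "\<phi> g = {x. val w x = Some g}" for g
  define \<psi> where "\<psi> = inv_into H \<phi>"
  have inj: "inj_on \<phi> H" 
  proof (rule inj_onI)
    fix g h assume "g \<in> H" "\<phi> g = \<phi> h"
    moreover from this obtain x where "x \<in> \<phi> g" by (auto simp: H_def \<phi>_def)
    ultimately have "x \<in> \<phi> g" "x \<in> \<phi> h" by simp_all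
    then show "g = h" by (simp add: \<phi>_def)
  qed
  have \<psi>\<phi>: "g \<in> H \<Longrightarrow> \<psi> (\<phi> g) = g" for g unfolding \<psi>_def using inj by simp
  have HG: "g \<in> H \<Longrightarrow> g \<in> carrier G" for g using cl by (auto simp: H_def)
  have Hm: "g \<otimes>\<^bsub>G\<^esub> h \<in> H" if "g \<in> H" "h \<in> H" for g h
  proof -
    from that obtain x y where "val w x = Some g" "val w y = Some h" by (auto simp: H_def)
    then have "val w (x * y) = Some (g \<otimes>\<^bsub>G\<^esub> h)" by (simp add: mul ext_plus_def)
    then show ?thesis by (auto simp: H_def)
  qed
  have one: "val w 1 = Some \<one>\<^bsub>G\<^esub>"
  proof -
    obtain g where g: "val w 1 = Some g" using zero[of 1] by auto
    have "g \<otimes>\<^bsub>G\<^esub> g = g" using mul[of 1 1] g by (simp add: ext_plus_def)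
    then have "g = \<one>\<^bsub>G\<^esub>" using cl[OF g] using l_cancel_one by blast
    then show ?thesis using g by simp
  qed
  have H1: "\<one>\<^bsub>G\<^esub> \<in> H" using one by (auto simp: H_def)
  have Hinv: "\<exists>h\<in>H. h \<otimes>\<^bsub>G\<^esub> g = \<one>\<^bsub>G\<^esub>" if "g \<in> H" for g
  proof -
    from that obtain x where x: "val w x = Some g" by (auto simp: H_def)
    then have "x \<noteq> 0" using zero[of x] by auto
    then obtain h where h: "val w (inverse x) = Some h" using zero[of "inverse x"] by auto
    have "h \<otimes>\<^bsub>G\<^esub> g = \<one>\<^bsub>G\<^esub>"
      using mul[of "inverse x" x] x h \<open>x \<noteq> 0\<close> one by (simp add: ext_plus_def)
    then show ?thesis using h by (auto simp: H_def)
  qed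
  define G' :: "'a set monoid" where
    "G' = \<lparr>carrier = \<phi> ` H, monoid.mult = (\<lambda>A B. \<phi> (\<psi> A \<otimes>\<^bsub>G\<^esub> \<psi> B)), one = \<phi> \<one>\<^bsub>G\<^esub>\<rparr>"
  define r' where "r' = {(\<phi> g, \<phi> h) | g h. g \<in> H \<and> h \<in> H \<and> (g, h) \<in> r}"
  define w' :: "('a, 'a set) valuation" where
    "w' = \<lparr>vgroup = G', vorder = r', val = (\<lambda>x. map_option \<phi> (val w x))\<rparr>"
  have r'_iff: "(\<phi> g, \<phi> h) \<in> r' \<longleftrightarrow> (g, h) \<in> r" if "g \<in> H" "h \<in> H" for g h
    unfolding r'_def using that inj by (auto simp: inj_on_eq_iff)
  have mult': "\<phi> g \<otimes>\<^bsub>G'\<^esub> \<phi> h = \<phi> (g \<otimes>\<^bsub>G\<^esub> h)" if "g \<in> H" "h \<in> H" for g h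
    using that by (simp add: G'_def \<psi>\<phi>)
  have carr': "carrier G' = \<phi> ` H" and one': "\<one>\<^bsub>G'\<^esub> = \<phi> \<one>\<^bsub>G\<^esub>" by (simp_all add: G'_def)
  have "comm_group G'"
  proof (rule comm_groupI)
    fix A assume "A \<in> carrier G'"
    then obtain g where g: "g \<in> H" "A = \<phi> g" by (auto simp: carr')
    then obtain h where "h \<in> H" "h \<otimes>\<^bsub>G\<^esub> g = \<one>\<^bsub>G\<^esub>" using Hinv by blast
    then show "\<exists>B\<in>carrier G'. B \<otimes>\<^bsub>G'\<^esub> A = \<one>\<^bsub>G'\<^esub>"
      using g by (intro bexI[of _ "\<phi> h"]) (auto simp: carr' one' mult')
  qed (auto simp: carr' one' mult' Hm H1 HG m_ac)
  moreover have "linear_order_on (carrier G') r'"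
  proof -
    have R: "refl_on (carrier G) r" "trans r" "antisym r" "total_on (carrier G) r"
      using lin by (auto simp: order_on_defs)
    have "refl_on (carrier G') r'"
      using R(1) HG by (auto simp: refl_on_def carr' r'_iff)
    moreover have "r' \<subseteq> carrier G' \<times> carrier G'" by (auto simp: r'_def carr')
    moreover have "trans r'"
    proof (rule transI)
      fix A B C assume "(A, B) \<in> r'" "(B, C) \<in> r'"
      then obtain a b c where abc: "A = \<phi> a" "B = \<phi> b" "C = \<phi> c" "a \<in> H" "b \<in> H" "c \<in> H"
        "(a, b) \<in> r" "(b, c) \<in> r"
        unfolding r'_def using inj by (auto simp: inj_on_eq_iff)
      with R(2) have "(a, c) \<in> r" by (meson transD)
      with abc show "(A, C) \<in> r'" by (simp add: r'_iff)
    qed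
    moreover have "antisym r'"
    proof (rule antisymI)
      fix A B assume "(A, B) \<in> r'" "(B, A) \<in> r'"
      then obtain a b where ab: "A = \<phi> a" "B = \<phi> b" "a \<in> H" "b \<in> H"
        "(a, b) \<in> r" "(b, a) \<in> r"
        unfolding r'_def using inj by (auto simp: inj_on_eq_iff)
      with R(3) show "A = B" by (auto dest: antisymD)
    qed
    moreover have "total_on (carrier G') r'"
      using R(4) HG unfolding total_on_def carr' by (metis imageE r'_iff)
    ultimately show ?thesis by (simp add: order_on_defs)
  qed
  moreover have "(A \<otimes>\<^bsub>G'\<^esub> C, B \<otimes>\<^bsub>G'\<^esub> C) \<in> r'" if "(A, B) \<in> r'" "C \<in> carrier G'" for A B C
  proof -
    from that obtain a b c where "A = \<phi> a" "B = \<phi> b" "C = \<phi> c" "a \<in> H" "b \<in> H" "c \<in> H"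
      "(a, b) \<in> r"
      by (auto simp: r'_def carr')
    then show ?thesis using mono[of a b c] by (simp add: mult' r'_iff Hm HG)
  qed
  ultimately have ocg: "ordered_comm_group G' r'"
    by (auto simp: ordered_comm_group_def)
  have inH: "val w x = Some g \<Longrightarrow> g \<in> H" for x g by (auto simp: H_def)
  have le': "ext_le r' (map_option \<phi> (val w x)) (map_option \<phi> (val w y)) \<longleftrightarrow>
      ext_le r (val w x) (val w y)" for x y
    using inH[of x] inH[of y] by (auto simp: ext_le_def r'_iff split: option.splits)
  have mul': "map_option \<phi> (val w (x * y)) =
      ext_plus G' (map_option \<phi> (val w x)) (map_option \<phi> (val w y))" for x y
    using inH[of x] inH[of y] unfolding mul
    by (auto simp: ext_plus_def mult' split: option.splits)
  have "krull_valuation w'"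
    unfolding krull_valuation_def w'_def using ocg add inH
    by (auto simp: le' carr' zero mul')
  moreover have "\<forall>x y. val_le w' x y \<longleftrightarrow> val_le w x y"
    by (simp add: val_le_def w'_def le' r_def[symmetric])
  ultimately show ?thesis by blast
qed

lemma krull_valuation_one:
  fixes w :: "('a::field, 'g) valuation"
  assumes w: "krull_valuation w"
  shows "val w 1 = Some \<one>\<^bsub>vgroup w\<^esub>"
proof -
  interpret comm_group "vgroup w"
    using w by (simp add: krull_valuation_def ordered_comm_group_def)
  have cl: "\<And>x g. val w x = Some g \<Longrightarrow> g \<in> carrier (vgroup w)"
    and zero: "\<And>x. val w x = None \<longleftrightarrow> x = 0"
    and mul: "\<And>x y. val w (x * y) = ext_plus (vgroup w) (val w x) (val w y)"
    using w by (auto simp: krull_valuation_def)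
  obtain g where g: "val w 1 = Some g" using zero[of 1] by auto
  have "g \<otimes>\<^bsub>vgroup w\<^esub> g = g" using mul[of 1 1] g by (simp add: ext_plus_def)
  then have "g = \<one>\<^bsub>vgroup w\<^esub>" using cl[OF g] using l_cancel_one by blast
  then show ?thesis using g by simp
qed

lemma val_eq_iff:
  fixes w :: "('a::field, 'g) valuation"
  assumes w: "krull_valuation w"
  shows "val w x = val w y \<longleftrightarrow> val_le w x y \<and> val_le w y x"
proof -
  have "refl_on (carrier (vgroup w)) (vorder w)" "antisym (vorder w)"
    and "\<And>x g. val w x = Some g \<Longrightarrow> g \<in> carrier (vgroup w)"
    using w by (auto simp: krull_valuation_def ordered_comm_group_def order_on_defs)
  then show ?thesis
    by (auto simp: val_le_def ext_le_def refl_on_def antisym_def split: option.splits)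
qed

lemma locality_of_val_le:
  fixes w :: "('a::field, 'g) valuation"
  assumes w: "krull_valuation w"
  shows "locality_of_val w =
           Locality {x. val_le w 1 x} {x. val_le w 1 x \<and> \<not> val_le w x 1}"
  using val_eq_iff[OF w, of _ 1]
  by (auto simp: locality_of_val_def krull_valuation_one[OF w, symmetric] val_le_def)

lemma locality_of_val_eqI:
  fixes w :: "('a::field, 'g) valuation" and w' :: "('a, 'h) valuation"
  assumes "krull_valuation w" and "krull_valuation w'"
    and "\<And>x y. val_le w' x y \<longleftrightarrow> val_le w x y"
  shows "locality_of_val w' = locality_of_val w"
  using assms by (simp add: locality_of_val_le)

lemma locality_of_val_transfer:
  fixes w :: "('a::field, 'g) valuation"
  assumes "krull_valuation w"
  shows "locality_of_val w \<in> val_localities"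
proof -
  obtain w' :: "('a, 'a set) valuation" where w': "krull_valuation w'"
    "\<And>x y. val_le w' x y \<longleftrightarrow> val_le w x y"
    using krull_valuation_transfer[OF assms] by blast
  have "locality_of_val w = locality_of_val w'"
    using locality_of_val_eqI[OF assms w'] by simp
  with w'(1) show ?thesis unfolding val_localities_def by blast
qed

lemma Mset_val:
  fixes w :: "('a::field, 'g) valuation"
  assumes w: "krull_valuation w"
  shows "Mset (locality_of_val w) = {x. x = 0 \<or> inverse x \<notin> Oset (locality_of_val w)}"
proof -
  interpret comm_group "vgroup w"
    using w by (simp add: krull_valuation_def ordered_comm_group_def)
  have cl: "\<And>x g. val w x = Some g \<Longrightarrow> g \<in> carrier (vgroup w)"
    and zero: "\<And>x. val w x = None \<longleftrightarrow> x = 0"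
    and mul: "\<And>x y. val w (x * y) = ext_plus (vgroup w) (val w x) (val w y)"
    and mono: "\<And>a b c. (a, b) \<in> vorder w \<Longrightarrow> c \<in> carrier (vgroup w) \<Longrightarrow>
      (a \<otimes>\<^bsub>vgroup w\<^esub> c, b \<otimes>\<^bsub>vgroup w\<^esub> c) \<in> vorder w"
    and tot: "refl_on (carrier (vgroup w)) (vorder w)" "total_on (carrier (vgroup w)) (vorder w)"
    using w by (auto simp: krull_valuation_def ordered_comm_group_def order_on_defs)
  have "val_le w 1 x \<and> \<not> val_le w x 1 \<longleftrightarrow> \<not> val_le w 1 (inverse x)" if nz: "x \<noteq> 0" for x
  proof -
    obtain g where g: "val w x = Some g" using zero[of x] nz by (cases "val w x") auto
    obtain h where h: "val w (inverse x) = Some h" using zero[of "inverse x"] nz by (cases "val w (inverse x)") auto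
    have hg: "h \<otimes>\<^bsub>vgroup w\<^esub> g = \<one>\<^bsub>vgroup w\<^esub>"
      using mul[of "inverse x" x] g h nz krull_valuation_one[OF w] by (simp add: ext_plus_def)
    have gc: "g \<in> carrier (vgroup w)" and hc: "h \<in> carrier (vgroup w)" using cl g h by auto
    have "(\<one>\<^bsub>vgroup w\<^esub>, h) \<in> vorder w \<longleftrightarrow> (g, \<one>\<^bsub>vgroup w\<^esub>) \<in> vorder w"
      using mono[of "\<one>\<^bsub>vgroup w\<^esub>" h g] mono[of g "\<one>\<^bsub>vgroup w\<^esub>" h] gc hc hg m_comm[OF gc hc]
      by auto
    moreover have "(\<one>\<^bsub>vgroup w\<^esub>, g) \<in> vorder w \<or> (g, \<one>\<^bsub>vgroup w\<^esub>) \<in> vorder w"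
      using tot gc by (metis one_closed refl_onD total_on_def)
    ultimately show ?thesis
      using g h by (auto simp: val_le_def ext_le_def krull_valuation_one[OF w])
  qed
  moreover have "val_le w 1 0 \<and> \<not> val_le w 0 1"
    using zero[of 0] zero[of 1] by (auto simp: val_le_def ext_le_def split: option.splits)
  ultimately show ?thesis
    unfolding locality_of_val_le[OF w] locality.sel
    by (metis (mono_tags, lifting) Collect_cong mem_Collect_eq)
qed

lemma Mset_abs:
  assumes f: "absolute_value f"
  shows "Mset (locality_of_abs f) = {x. x = 0 \<or> inverse x \<notin> Oset (locality_of_abs f)}"
proof -
  have f0: "\<And>x. f x = 0 \<longleftrightarrow> x = 0" and fm: "\<And>x y. f (x * y) = f x * f y"
    and fp: "\<And>x. 0 \<le> f x"
    using f by (auto simp: absolute_value_def)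
  have "f x < 1 \<longleftrightarrow> \<not> f (inverse x) \<le> 1" if "x \<noteq> 0" for x
  proof -
    have "f 1 * f 1 = f 1" using fm[of 1 1] by simp
    then have "f 1 = 1" using f0[of 1] by simp
    then have i: "f (inverse x) = inverse (f x)"
      using fm[of "inverse x" x] that f0[of x] by (simp add: field_simps)
    have "f x > 0" using fp[of x] f0[of x] that by linarith
    then show ?thesis using i by (simp add: one_less_inverse_iff not_le)
  qed
  moreover have "f 0 = 0" using f0 by simp
  ultimately show ?thesis
    unfolding locality_of_abs_def locality.sel by (metis (mono_tags, lifting) Collect_cong mem_Collect_eq zero_less_one)
qed

lemma Mset_ord:
  assumes r: "field_ordering r"
  shows "Mset (locality_of_ord r) = {x. x = 0 \<or> inverse x \<notin> Oset (locality_of_ord r)}"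
proof -
  define P where "P x \<longleftrightarrow> (0, x) \<in> r" for x
  have R: "refl_on UNIV r" "trans r" "antisym r" "total_on UNIV r"
    and add: "\<And>x y z. (x, y) \<in> r \<Longrightarrow> (x + z, y + z) \<in> r"
    and mul: "\<And>x y. P x \<Longrightarrow> P y \<Longrightarrow> P (x * y)"
    using r by (auto simp: field_ordering_def order_on_defs P_def)
  have le: "(x, y) \<in> r \<longleftrightarrow> P (y - x)" for x y
    using add[of x y "- x"] add[of 0 "y - x" x] by (auto simp: P_def)
  have tot: "P x \<or> P (- x)" for x
  proof -
    have "(0, x) \<in> r \<or> (x, 0) \<in> r"
      using R(1,4) by (cases "x = 0") (auto simp: total_on_def dest: refl_onD)
    then show ?thesis using le[of x 0] by (auto simp: P_def)
  qed
  have anti: "x = 0" if "P x" "P (- x)" for x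
    using that R(3) le[of x 0] by (auto simp: P_def antisym_def)
  have plus: "P (x + y)" if "P x" "P y" for x y
  proof -
    have "(x, x + y) \<in> r" using that(2) by (simp add: le)
    then show ?thesis using that(1) R(2) unfolding P_def by (meson transD)
  qed
  have sq: "P (x * x)" for x using tot[of x] mul[of x x] mul[of "- x" "- x"] by auto
  have P1: "P 1" using sq[of 1] by simp
  have bd: "P (1 + x) \<and> P (1 - x) \<longleftrightarrow> P (1 - x * x)" for x
  proof
    assume "P (1 + x) \<and> P (1 - x)"
    then show "P (1 - x * x)" using mul[of "1 + x" "1 - x"] by (simp add: algebra_simps)
  next
    assume a: "P (1 - x * x)"
    have "P (1 + y)" if b: "P (1 - y * y)" for y
    proof (rule ccontr)
      assume n: "\<not> P (1 + y)"
      then have y: "P (- (1 + y))" using tot by blast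
      then have "P (- (1 + y) * (1 - y))"
        using mul[OF y, of "1 - y"] plus[OF y plus[OF P1 P1]] by (simp add: algebra_simps)
      then have "P (- (1 - y * y))" by (simp add: algebra_simps)
      with b have "1 - y * y = 0" using anti by blast
      then have "(1 + y) * (1 - y) = 0" by (simp add: algebra_simps)
      then have "1 + y = 0 \<or> y = 1" by auto
      moreover have "P (0::'a)" using R(1) by (auto simp: P_def dest: refl_onD)
      ultimately show False using n plus[OF P1 P1] by auto
    qed
    from this[of x] this[of "- x"] a show "P (1 + x) \<and> P (1 - x)" by simp
  qed
  have O: "(- 1, x) \<in> r \<and> (x, 1) \<in> r \<longleftrightarrow> P (1 - x * x)" for x
    by (simp add: le bd add.commute)
  have M: "(- 1, x) \<in> r \<and> x \<noteq> - 1 \<and> (x, 1) \<in> r \<and> x \<noteq> 1 \<longleftrightarrow> \<not> P (x * x - 1)" for x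
  proof -
    have "x * x - 1 = 0 \<longleftrightarrow> x = 1 \<or> x = - 1"
      by (metis eq_iff_diff_eq_0 square_eq_1_iff)
    moreover have "P (0::'a)" using R(1) by (auto simp: P_def dest: refl_onD)
    ultimately show ?thesis
      using O[of x] tot[of "x * x - 1"] anti[of "x * x - 1"] by auto
  qed
  have "\<not> P (x * x - 1) \<longleftrightarrow> \<not> P (1 - inverse x * inverse x)" if "x \<noteq> 0" for x
  proof -
    have "x * x * (1 - inverse x * inverse x) = x * x - 1"
      and "inverse x * inverse x * (x * x - 1) = 1 - inverse x * inverse x"
      using that by (simp_all add: field_simps)
    then show ?thesis
      using mul[OF sq[of x], of "1 - inverse x * inverse x"]
        mul[OF sq[of "inverse x"], of "x * x - 1"] by auto
  qed
  moreover have "\<not> P (0 * 0 - 1)" using anti[OF P1] by auto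
  ultimately show ?thesis
    unfolding locality_of_ord_def locality.sel O M by (metis (mono_tags, lifting) Collect_cong mem_Collect_eq)
qed

lemma Mset_eq_if_locality:
  assumes "v \<in> localities"
  shows "Mset v = {x. x = 0 \<or> inverse x \<notin> Oset v}"
  using assms Mset_val Mset_ord Mset_abs
  unfolding localities_def val_localities_def ord_localities_def abs_localities_def by blast

lemma locality_eqI:
  assumes "v \<in> localities" "w \<in> localities" "Oset v = Oset w"
  shows "v = w"
  using Mset_eq_if_locality[OF assms(1)] Mset_eq_if_locality[OF assms(2)] assms(3)
  by (cases v; cases w) simp

lemma zero_mem_Mset: "v \<in> localities \<Longrightarrow> 0 \<in> Mset v"
  by (simp add: Mset_eq_if_locality)

lemma Mset_subset_Oset: "v \<in> localities \<Longrightarrow> Mset v \<subseteq> Oset v"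
  by (auto simp: localities_def val_localities_def ord_localities_def abs_localities_def
      locality_of_val_def locality_of_ord_def locality_of_abs_def)

lemma topspace_zariski: "topspace zariski = localities"
  unfolding zariski_def topology_generated_by_topspace
  using zero_mem_Mset Mset_subset_Oset by blast

lemma topspace_zariski_star: "topspace zariski_star = localities"
  unfolding zariski_star_def topology_generated_by_topspace
  using zero_mem_Mset by blast

lemma join_eqI:
  assumes "finest_common_coarsening v w u"
  shows "join v w = u"
  unfolding join_def
proof (rule the_equality)
  fix u' assume "finest_common_coarsening v w u'"
  with assms show "u' = u"
    by (auto simp: finest_common_coarsening_def refines_def intro!: locality_eqI)
qed (rule assms)

end

theory Submission
  imports Defs
begin

text \<open>
  One set is added at a time: if \<open>x'\<close> solves the problem for \<open>S\<^sub>1, \<dots>, S\<^sub>n\<^sub>-\<^sub>1\<close>, one looks for an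
  \<open>e\<close> close to \<open>0\<close> on these sets and close to \<open>1\<close> on \<open>S\<^sub>n\<close> and passes to \<open>x' + e (x\<^sub>n - x')\<close>. Such an
  \<open>e\<close> is \<open>a\<^sub>d y\<^sup>d / f(y)\<close> for any \<open>y\<close> that is small on the first sets and large on \<open>S\<^sub>n\<close>. Since
  \<open>b\<^sup>d f(a/b)\<close> behaves like the \<open>d\<close>-th power of a maximum, finitely many elements can be
  combined into one, and compactness reduces the construction of \<open>y\<close> to a single pair \<open>v, w\<close>. For a
  pair it amounts to the fact that the finest common coarsening of two (strongly) incomparable
  localities has the set of products \<open>\<O>\<^sub>v \<O>\<^sub>w\<close> as its valuation ring.
\<close>

text \<open>For orderings and archimedean absolute values \<open>Oset v\<close> is not closed under
  sums, so each addition and each division by a value of \<open>f\<close> costs a factor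
  \<open>t\<close>. Compactness combines an uncontrolled number of elements, so these losses must
  not accumulate: smallness is required relative to \<open>t\<close> as well as to the target
  precision, and \<open>degree f \<ge> 2\<close> then gives the lost factor back. The bounded loss
  that remains is absorbed into the precision. This is permitted because \<open>t\<close> is a unit
  at every join, so that \<open>inverse t\<close> lies in every valuation ring above both localities
  of a pair. Hypothesis (I) has the same shape: it puts \<open>(x i - x j) / z i\<close> and
  \<open>z i / z j\<close> into all such rings. Factoring a required inverse precision in
  \<open>Oset v * Oset w\<close> is then what separates the pair. That this product set is a ring
  can fail for two orderings: if they have the same bounded elements and the same residue ordering,
  2 is not in it. Strong incomparability excludes this.\<close>

lemma mem_elt_set_times_iff:
  fixes c :: "'a::field"
  assumes "c \<noteq> 0"
  shows "x \<in> c *o A \<longleftrightarrow> x / c \<in> A"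
  using assms by (force simp: elt_set_times_def field_simps)

section \<open>Valuation rings\<close>

definition valuation_subring :: "'a::field set \<Rightarrow> bool" where
  "valuation_subring R \<longleftrightarrow>
     (\<forall>x\<in>R. \<forall>y\<in>R. x - y \<in> R \<and> x * y \<in> R) \<and> (\<forall>x. x \<in> R \<or> inverse x \<in> R)"

context
  fixes R :: "'a::field set"
  assumes R: "valuation_subring R"
begin

lemma valuation_subring_diff: "x \<in> R \<Longrightarrow> y \<in> R \<Longrightarrow> x - y \<in> R"
  and valuation_subring_mult: "x \<in> R \<Longrightarrow> y \<in> R \<Longrightarrow> x * y \<in> R"
  and valuation_subring_total: "x \<in> R \<or> inverse x \<in> R"
  using R by (auto simp: valuation_subring_def)

lemma valuation_subring_1: "1 \<in> R"
  using valuation_subring_total[of 1] by simp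

lemma valuation_subring_0: "0 \<in> R"
  using valuation_subring_total[of 0] by simp

lemma valuation_subring_uminus: "x \<in> R \<Longrightarrow> - x \<in> R"
  using valuation_subring_diff[OF valuation_subring_0, of x] by simp

lemma valuation_subring_add: "x \<in> R \<Longrightarrow> y \<in> R \<Longrightarrow> x + y \<in> R"
  using valuation_subring_diff[of x "- y"] valuation_subring_uminus by simp

lemma valuation_subring_of_nat: "of_nat k \<in> R"
  by (induction k) (auto intro: valuation_subring_0 valuation_subring_1 valuation_subring_add)

end

lemma valuation_subring_UNIV: "valuation_subring UNIV"
  by (simp add: valuation_subring_def)

text \<open>Only sums are at issue. Of two elements of a valuation ring one divides the other, so
  taking a divisor out of the \<open>A\<close>-factors and then out of the \<open>B\<close>-factors
  of \<open>a * b + c * d\<close> leaves the shapes \<open>a * b + 1\<close> and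
  \<open>a + b\<close>. For these, either both terms lie in one of the rings or a further factor can
  be taken out.\<close>

lemma valuation_subring_times:
  fixes A B :: "'a::field set"
  assumes A: "valuation_subring A" and B: "valuation_subring B"
  shows "valuation_subring (A * B)"
proof -
  note A_closed = valuation_subring_mult[OF A] valuation_subring_add[OF A] valuation_subring_1[OF A]
  note B_closed = valuation_subring_mult[OF B] valuation_subring_add[OF B] valuation_subring_1[OF B]
  have I: "a * b \<in> A * B" if "a \<in> A" "b \<in> B" for a b
    using that by (rule set_times_intro)
  have IA: "a \<in> A * B" if "a \<in> A" for a
    using I[OF that B_closed(3)] by simp
  have IB: "b \<in> A * B" if "b \<in> B" for b
    using I[OF A_closed(3) that] by simp
  have mult: "x * y \<in> A * B" if xy: "x \<in> A * B" "y \<in> A * B" for x y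
  proof -
    obtain a b c d where "x = a * b" "y = c * d" "a \<in> A" "b \<in> B" "c \<in> A" "d \<in> B"
      using xy by (meson set_times_elim)
    then show ?thesis
      using I[of "a * c" "b * d"] A_closed B_closed by (simp add: mult_ac)
  qed
  have add': "a + b \<in> A * B" if ab: "a \<in> A" "b \<in> B" for a b
  proof (cases "b = 0")
    case False
    consider "a / b \<in> A" | "b / a \<in> A"
      using valuation_subring_total[OF A, of "a / b"] by auto
    then show ?thesis
    proof cases
      case 1
      moreover have "a + b = (a / b + 1) * b" using False by (simp add: field_simps)
      ultimately show ?thesis using I[of "a / b + 1" b] ab(2) A_closed by metis
    next
      case 2
      show ?thesis
      proof (cases "a = 0")
        case False
        then have "b = (b / a) * a" by simp
        then have "b \<in> A" using 2 ab A_closed(1) by metis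
        then show ?thesis using ab A_closed(2) IA by blast
      qed (use IB ab in simp)
    qed
  qed (use IA ab in simp)
  have add1: "a * b + 1 \<in> A * B" if ab: "a \<in> A" "b \<in> B" for a b
  proof (cases "a = 0")
    case False
    from valuation_subring_total[OF B, of a] show ?thesis
    proof
      assume "a \<in> B"
      then show ?thesis using IB ab B_closed by simp
    next
      assume "inverse a \<in> B"
      moreover have "a * b + 1 = a * (b + inverse a)" using False by (simp add: distrib_left)
      ultimately show ?thesis using I[OF ab(1)] ab(2) B_closed(2) by metis
    qed
  qed (use IA A_closed in simp)
  have add2: "a * b + d \<in> A * B" if ab: "a \<in> A" "b \<in> B" "d \<in> B" for a b d
  proof -
    consider "b = 0" | "d = 0" | "b \<noteq> 0" "d \<noteq> 0" "b / d \<in> B" | "b \<noteq> 0" "d \<noteq> 0" "d / b \<in> B"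
      using valuation_subring_total[OF B, of "b / d"] by fastforce
    then show ?thesis
    proof cases
      case 3
      then have "d * (a * (b / d) + 1) \<in> A * B"
        using mult[OF IB[OF ab(3)] add1[OF ab(1), of "b / d"]] by simp
      moreover have "d * (a * (b / d) + 1) = a * b + d" using 3 by (simp add: algebra_simps)
      ultimately show ?thesis by metis
    next
      case 4
      then have "b * (a + d / b) \<in> A * B"
        using mult[OF IB[OF ab(2)] add'[OF ab(1), of "d / b"]] by simp
      moreover have "b * (a + d / b) = a * b + d" using 4 by (simp add: algebra_simps)
      ultimately show ?thesis by metis
    qed (use IB I ab in auto)
  qed
  have add: "x + y \<in> A * B" if xy: "x \<in> A * B" "y \<in> A * B" for x y
  proof -
    obtain a b c d where eq: "x = a * b" "y = c * d" and mem: "a \<in> A" "b \<in> B" "c \<in> A" "d \<in> B"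
      using xy by (meson set_times_elim)
    consider "a = 0" | "c = 0" | "a \<noteq> 0" "c \<noteq> 0" "a / c \<in> A" | "a \<noteq> 0" "c \<noteq> 0" "c / a \<in> A"
      using valuation_subring_total[OF A, of "a / c"] by fastforce
    then show ?thesis
    proof cases
      case 3
      then have "c * ((a / c) * b + d) \<in> A * B"
        using mult[OF IA[OF mem(3)] add2[of "a / c" b d]] mem by simp
      moreover have "c * ((a / c) * b + d) = x + y" using 3 eq by (simp add: algebra_simps)
      ultimately show ?thesis by metis
    next
      case 4
      then have "a * ((c / a) * d + b) \<in> A * B"
        using mult[OF IA[OF mem(1)] add2[of "c / a" d b]] mem by simp
      moreover have "a * ((c / a) * d + b) = x + y" using 4 eq by (simp add: algebra_simps)
      ultimately show ?thesis by metis
    qed (use xy eq in auto)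
  qed
  have "x - y \<in> A * B" if "x \<in> A * B" "y \<in> A * B" for x y
    using add[OF that(1) mult[OF IA[OF valuation_subring_uminus[OF A A_closed(3)]] that(2)]] by simp
  moreover have "x \<in> A * B \<or> inverse x \<in> A * B" for x
    using valuation_subring_total[OF A, of x] IA by blast
  ultimately show ?thesis
    using mult unfolding valuation_subring_def by blast
qed

text \<open>The value group is the multiplicative group of the field modulo the units of
  \<open>R\<close>, ordered by divisibility. Its elements are cosets, hence of type
  \<open>'a set\<close>, the type over which the hypothesis on valuations quantifies.\<close>

lemma valuation_subring_obtains_valuation:
  fixes R :: "'a::field set"
  assumes R: "valuation_subring R"
  obtains w :: "('a, 'a set) valuation" where "krull_valuation w"
    "\<And>x y. val_le w x y \<longleftrightarrow> y = 0 \<or> x \<noteq> 0 \<and> y / x \<in> R"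
proof -
  define U where "U = {u. u \<noteq> 0 \<and> u \<in> R \<and> inverse u \<in> R}"
  define G :: "'a set monoid" where
    "G = \<lparr>carrier = {x *o U | x. x \<noteq> 0}, monoid.mult = (*), one = 1 *o U\<rparr>"
  define r where "r = {(x *o U, y *o U) | x y. x \<noteq> 0 \<and> y \<noteq> 0 \<and> y / x \<in> R}"
  define w :: "('a, 'a set) valuation" where
    "w = \<lparr>vgroup = G, vorder = r, val = (\<lambda>x. if x = 0 then None else Some (x *o U))\<rparr>"
  note closed = valuation_subring_mult[OF R] valuation_subring_add[OF R] valuation_subring_1[OF R]
  have U1: "1 \<in> U" using closed by (simp add: U_def)
  have U_mult: "u * u' \<in> U" if "u \<in> U" "u' \<in> U" for u u'
    using that closed by (simp add: U_def)
  have U_inv: "inverse u \<in> U" if "u \<in> U" for u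
    using that by (simp add: U_def)
  have coset_eq: "x *o U = y *o U \<longleftrightarrow> y / x \<in> U" if xy: "x \<noteq> 0" "y \<noteq> 0" for x y
  proof
    assume eq: "x *o U = y *o U"
    have "y \<in> y *o U" using U1 by (force simp: elt_set_times_def)
    then show "y / x \<in> U" using eq mem_elt_set_times_iff[OF xy(1)] by blast
  next
    assume yx: "y / x \<in> U"
    have "a / x \<in> U \<longleftrightarrow> a / y \<in> U" for a
      using U_mult[of "a / y" "y / x"] U_mult[of "a / x" "inverse (y / x)"] U_inv[OF yx] yx xy by auto
    then show "x *o U = y *o U"
      using mem_elt_set_times_iff[OF xy(1)] mem_elt_set_times_iff[OF xy(2)] by blast
  qed
  have coset_mult: "(x *o U) * (y *o U) = (x * y) *o U" if xy: "x \<noteq> 0" "y \<noteq> 0" for x y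
  proof
    show "(x *o U) * (y *o U) \<subseteq> (x * y) *o U"
    proof
      fix a assume "a \<in> (x *o U) * (y *o U)"
      then obtain u u' where "u \<in> U" "u' \<in> U" "a = (x * u) * (y * u')"
        by (auto simp: set_times_def elt_set_times_def)
      then show "a \<in> (x * y) *o U"
        using U_mult by (auto simp: elt_set_times_def mult_ac intro!: bexI[of _ "u * u'"])
    qed
    show "(x * y) *o U \<subseteq> (x *o U) * (y *o U)"
    proof
      fix a assume "a \<in> (x * y) *o U"
      then obtain u where u: "u \<in> U" "a = (x * u) * (y * 1)"
        by (auto simp: elt_set_times_def mult_ac)
      then show "a \<in> (x *o U) * (y *o U)"
        using U1 unfolding u(2) by (intro set_times_intro) (auto simp: elt_set_times_def)
    qed
  qed
  have r_iff: "(x *o U, y *o U) \<in> r \<longleftrightarrow> y / x \<in> R" if xy: "x \<noteq> 0" "y \<noteq> 0" for x y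
  proof
    assume "(x *o U, y *o U) \<in> r"
    then obtain x' y' where *: "x *o U = x' *o U" "y *o U = y' *o U" "x' \<noteq> 0" "y' \<noteq> 0" "y' / x' \<in> R"
      by (auto simp: r_def)
    then have "x' / x \<in> R" "inverse (y' / y) \<in> R" using coset_eq xy by (auto simp: U_def)
    then have "(x' / x) * ((y' / x') * inverse (y' / y)) \<in> R" using * closed(1) by blast
    then show "y / x \<in> R" using * xy by (simp add: field_simps)
  qed (use xy in \<open>auto simp: r_def\<close>)
  have carr: "carrier G = {x *o U | x. x \<noteq> 0}" by (simp add: G_def)
  have G_mult: "x *o U \<otimes>\<^bsub>G\<^esub> y *o U = (x * y) *o U" if "x \<noteq> 0" "y \<noteq> 0" for x y
    using coset_mult[OF that] by (simp add: G_def)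
  have G_one: "\<one>\<^bsub>G\<^esub> = 1 *o U" by (simp add: G_def)
  have "comm_group G"
  proof (rule comm_groupI)
    fix A assume "A \<in> carrier G"
    then obtain a where "a \<noteq> 0" "A = a *o U" by (auto simp: carr)
    then show "\<exists>B\<in>carrier G. B \<otimes>\<^bsub>G\<^esub> A = \<one>\<^bsub>G\<^esub>"
      by (intro bexI[of _ "inverse a *o U"]) (auto simp: carr G_mult G_one)
  next
    fix A B assume "A \<in> carrier G" "B \<in> carrier G"
    then obtain a b where *: "a \<noteq> 0" "b \<noteq> 0" "A = a *o U" "B = b *o U" by (auto simp: carr)
    then show "A \<otimes>\<^bsub>G\<^esub> B \<in> carrier G" by (auto simp: carr G_mult)
    from * show "A \<otimes>\<^bsub>G\<^esub> B = B \<otimes>\<^bsub>G\<^esub> A" by (simp add: G_mult mult.commute)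
    fix C assume "C \<in> carrier G"
    then obtain c where "c \<noteq> 0" "C = c *o U" by (auto simp: carr)
    with * show "A \<otimes>\<^bsub>G\<^esub> B \<otimes>\<^bsub>G\<^esub> C = A \<otimes>\<^bsub>G\<^esub> (B \<otimes>\<^bsub>G\<^esub> C)" by (simp add: G_mult mult.assoc)
  next
    show "\<one>\<^bsub>G\<^esub> \<in> carrier G" by (auto simp: carr G_one intro: exI[of _ 1])
    fix A assume "A \<in> carrier G"
    then obtain a where "a \<noteq> 0" "A = a *o U" by (auto simp: carr)
    then show "\<one>\<^bsub>G\<^esub> \<otimes>\<^bsub>G\<^esub> A = A" using G_mult[of 1 a] by (simp add: G_one)
  qed
  moreover have "linear_order_on (carrier G) r"
  proof -
    have "r \<subseteq> carrier G \<times> carrier G" by (auto simp: r_def carr)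
    moreover have "refl_on (carrier G) r"
      by (rule refl_onI) (auto simp: carr r_iff closed)
    moreover have "trans r"
    proof (rule transI)
      fix A B C assume ABC: "(A, B) \<in> r" "(B, C) \<in> r"
      then obtain a b c where *: "a \<noteq> 0" "b \<noteq> 0" "c \<noteq> 0" "A = a *o U" "B = b *o U" "C = c *o U"
        by (auto simp: r_def)
      with ABC have "b / a \<in> R" "c / b \<in> R" by (auto simp: r_iff)
      from closed(1)[OF this] * show "(A, C) \<in> r" by (simp add: r_iff)
    qed
    moreover have "antisym r"
    proof (rule antisymI)
      fix A B assume AB: "(A, B) \<in> r" "(B, A) \<in> r"
      then obtain a b where *: "a \<noteq> 0" "b \<noteq> 0" "A = a *o U" "B = b *o U" by (auto simp: r_def)
      with AB have "b / a \<in> R" "a / b \<in> R" by (auto simp: r_iff)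
      with * show "A = B" using coset_eq[of a b] by (simp add: U_def)
    qed
    moreover have "total_on (carrier G) r"
    proof (rule total_onI)
      fix A B assume "A \<in> carrier G" "B \<in> carrier G"
      then obtain a b where *: "a \<noteq> 0" "b \<noteq> 0" "A = a *o U" "B = b *o U" by (auto simp: carr)
      then show "(A, B) \<in> r \<or> (B, A) \<in> r"
        using valuation_subring_total[OF R, of "b / a"] by (simp add: r_iff)
    qed
    ultimately show ?thesis by (auto simp: order_on_defs)
  qed
  moreover have "(A \<otimes>\<^bsub>G\<^esub> C, B \<otimes>\<^bsub>G\<^esub> C) \<in> r" if ABC: "(A, B) \<in> r" "C \<in> carrier G" for A B C
  proof -
    from ABC obtain a b c where *: "a \<noteq> 0" "b \<noteq> 0" "c \<noteq> 0" "A = a *o U" "B = b *o U" "C = c *o U"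
      by (auto simp: r_def carr)
    with ABC show ?thesis by (simp add: r_iff G_mult)
  qed
  ultimately have ocg: "ordered_comm_group G r" unfolding ordered_comm_group_def by blast
  have le: "val_le w x y \<longleftrightarrow> y = 0 \<or> x \<noteq> 0 \<and> y / x \<in> R" for x y
    by (simp add: val_le_def w_def ext_le_def r_iff)
  have "val_le w x (x + y) \<or> val_le w y (x + y)" for x y
  proof (cases "x = 0 \<or> y = 0")
    case False
    then show ?thesis
      using valuation_subring_total[OF R, of "x / y"] closed(2,3) by (auto simp: le add_divide_distrib)
  qed (use closed(3) in \<open>auto simp: le\<close>)
  moreover have "val w (x * y) = ext_plus (vgroup w) (val w x) (val w y)" for x y
    by (simp add: w_def ext_plus_def G_mult)
  moreover have "val w x = Some g \<Longrightarrow> g \<in> carrier (vgroup w)" "val w x = None \<longleftrightarrow> x = 0" for x g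
    by (auto simp: w_def carr split: if_splits)
  ultimately have "krull_valuation w"
    using ocg unfolding krull_valuation_def val_le_def by (auto simp: w_def)
  then show ?thesis using that le by blast
qed

lemma valuation_subring_obtains_locality:
  fixes R :: "'a::field set"
  assumes "valuation_subring R"
  obtains u where "u \<in> localities" "Oset u = R"
proof -
  obtain w :: "('a, 'a set) valuation" where w: "krull_valuation w"
    "\<And>x y. val_le w x y \<longleftrightarrow> y = 0 \<or> x \<noteq> 0 \<and> y / x \<in> R"
    using valuation_subring_obtains_valuation[OF assms] by blast
  show ?thesis
  proof (rule that)
    show "locality_of_val w \<in> localities"
      using w(1) by (auto simp: localities_def val_localities_def)
    show "Oset (locality_of_val w) = R"
      using valuation_subring_0[OF assms] by (auto simp: locality_of_val_le[OF w(1)] w(2))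
  qed
qed

section \<open>Arithmetic of localities\<close>

lemma absolute_valueD:
  assumes "absolute_value f"
  shows "0 \<le> f x" "f x = 0 \<longleftrightarrow> x = 0" "f (x * y) = f x * f y" "f (x + y) \<le> f x + f y"
  using assms by (auto simp: absolute_value_def)

lemma absolute_value_1:
  assumes "absolute_value f"
  shows "f 1 = 1"
  using absolute_valueD(2,3)[OF assms, of 1] by (metis mult_1 mult_cancel_right zero_neq_one)

lemma absolute_value_uminus:
  assumes f: "absolute_value f"
  shows "f (- x) = f x"
proof -
  have "f (- 1) * f (- 1) = 1"
    using absolute_valueD(3)[OF f, of "- 1" "- 1"] absolute_value_1[OF f] by simp
  then have "f (- 1) = 1"
    using absolute_valueD(1)[OF f, of "- 1"] by (simp add: square_eq_1_iff)
  then show ?thesis using absolute_valueD(3)[OF f, of "- 1" x] by simp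
qed

lemma absolute_value_power:
  assumes f: "absolute_value f"
  shows "f (x ^ k) = f x ^ k"
  by (induction k) (simp_all add: absolute_value_1[OF f] absolute_valueD(3)[OF f])

lemma Oset_abs: "Oset (locality_of_abs f) = {x. f x \<le> 1}"
  and Mset_of_abs: "Mset (locality_of_abs f) = {x. f x < 1}"
  by (simp_all add: locality_of_abs_def)

lemma valuation_subring_Oset_val:
  fixes v :: "'a::field locality"
  assumes "v \<in> val_localities"
  shows "valuation_subring (Oset v)"
proof -
  obtain w :: "('a, 'a set) valuation" where w: "krull_valuation w" "v = locality_of_val w"
    using assms by (auto simp: val_localities_def)
  interpret comm_group "vgroup w"
    using w by (simp add: krull_valuation_def ordered_comm_group_def)
  have cl: "\<And>x g. val w x = Some g \<Longrightarrow> g \<in> carrier (vgroup w)"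
    and mul: "\<And>x y. val w (x * y) = ext_plus (vgroup w) (val w x) (val w y)"
    and add: "\<And>x y. ext_le (vorder w) (val w x) (val w (x + y)) \<or>
      ext_le (vorder w) (val w y) (val w (x + y))"
    and mono: "\<And>a b c. (a, b) \<in> vorder w \<Longrightarrow> c \<in> carrier (vgroup w) \<Longrightarrow>
      (a \<otimes>\<^bsub>vgroup w\<^esub> c, b \<otimes>\<^bsub>vgroup w\<^esub> c) \<in> vorder w"
    and tr: "trans (vorder w)"
    using w by (auto simp: krull_valuation_def ordered_comm_group_def order_on_defs)
  have O: "x \<in> Oset v \<longleftrightarrow> ext_le (vorder w) (Some \<one>\<^bsub>vgroup w\<^esub>) (val w x)" for x
    by (simp add: w(2) locality_of_val_def)
  have mult: "x * y \<in> Oset v" if xy: "x \<in> Oset v" "y \<in> Oset v" for x y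
  proof (cases "val w x = None \<or> val w y = None")
    case False
    then obtain g h where gh: "val w x = Some g" "val w y = Some h" by auto
    then have "(\<one>\<^bsub>vgroup w\<^esub>, g) \<in> vorder w" "(\<one>\<^bsub>vgroup w\<^esub>, h) \<in> vorder w"
      using xy by (auto simp: O ext_le_def)
    then have "(\<one>\<^bsub>vgroup w\<^esub>, g \<otimes>\<^bsub>vgroup w\<^esub> h) \<in> vorder w"
      using mono[of "\<one>\<^bsub>vgroup w\<^esub>" g h] cl[OF gh(2)] tr by (auto dest: transD)
    then show ?thesis by (simp add: O mul gh ext_plus_def ext_le_def)
  qed (auto simp: O mul ext_plus_def ext_le_def split: option.splits)
  have ext_trans: "ext_le (vorder w) a c" if "ext_le (vorder w) a b" "ext_le (vorder w) b c" for a b c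
    using that tr by (auto simp: ext_le_def split: option.splits dest: transD)
  have add': "x + y \<in> Oset v" if "x \<in> Oset v" "y \<in> Oset v" for x y
    using that add[of x y] ext_trans unfolding O by blast
  have v: "v \<in> localities" using assms by (simp add: localities_def)
  have total: "x \<in> Oset v \<or> inverse x \<in> Oset v" for x
    using Mset_eq_if_locality[OF v] Mset_subset_Oset[OF v] by blast
  \<comment> \<open>\<open>- 1\<close> is its own inverse, so totality decides.\<close>
  have m1: "- 1 \<in> Oset v"
    using total[of "- 1"] by simp
  have "x - y \<in> Oset v" if "x \<in> Oset v" "y \<in> Oset v" for x y
    using add'[OF that(1) mult[OF m1 that(2)]] by simp
  with mult total show ?thesis by (auto simp: valuation_subring_def)
qed

section \<open>Orderings through their sets of nonnegative elements\<close>

definition positive_cone :: "('a::field \<Rightarrow> bool) \<Rightarrow> bool" where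
  "positive_cone P \<longleftrightarrow> (\<forall>x y. P x \<and> P y \<longrightarrow> P (x + y) \<and> P (x * y)) \<and>
     (\<forall>x. P x \<or> P (- x)) \<and> (\<forall>x. P x \<and> P (- x) \<longrightarrow> x = 0)"

lemma ord_locality_positive_cone:
  fixes v :: "'a::field locality"
  assumes "v \<in> ord_localities"
  obtains P where "positive_cone P" "Oset v = {x. P (1 - x) \<and> P (1 + x)}"
proof -
  obtain r where r: "field_ordering r" and v: "v = locality_of_ord r"
    using assms by (auto simp: ord_localities_def)
  define P where "P x \<longleftrightarrow> (0, x) \<in> r" for x
  have R: "refl_on UNIV r" "trans r" "antisym r" "total_on UNIV r"
    and add: "\<And>x y z. (x, y) \<in> r \<Longrightarrow> (x + z, y + z) \<in> r"
    and mul: "\<And>x y. P x \<Longrightarrow> P y \<Longrightarrow> P (x * y)"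
    using r by (auto simp: field_ordering_def order_on_defs P_def)
  have le: "(x, y) \<in> r \<longleftrightarrow> P (y - x)" for x y
    using add[of x y "- x"] add[of 0 "y - x" x] by (auto simp: P_def)
  have "P x \<or> P (- x)" for x
  proof -
    have "(0, x) \<in> r \<or> (x, 0) \<in> r"
      using R(1,4) by (cases "x = 0") (auto simp: total_on_def dest: refl_onD)
    then show ?thesis using le[of x 0] by (auto simp: P_def)
  qed
  moreover have "x = 0" if "P x" "P (- x)" for x
    using that R(3) le[of x 0] by (auto simp: P_def antisym_def)
  moreover have "P (x + y)" if "P x" "P y" for x y
  proof -
    have "(x, x + y) \<in> r" using that(2) by (simp add: le)
    then show ?thesis using that(1) R(2) unfolding P_def by (meson transD)
  qed
  ultimately have "positive_cone P" using mul by (auto simp: positive_cone_def)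
  moreover have "Oset v = {x. P (1 - x) \<and> P (1 + x)}"
    by (auto simp: v locality_of_ord_def le add.commute)
  ultimately show ?thesis by (rule that)
qed

context
  fixes P :: "'a::field \<Rightarrow> bool"
  assumes P: "positive_cone P"
begin

lemma cone_add: "P x \<Longrightarrow> P y \<Longrightarrow> P (x + y)"
  and cone_mult: "P x \<Longrightarrow> P y \<Longrightarrow> P (x * y)"
  and cone_total: "P x \<or> P (- x)"
  and cone_antisym: "P x \<Longrightarrow> P (- x) \<Longrightarrow> x = 0"
  using P by (auto simp: positive_cone_def)

lemma cone_square: "P (x * x)"
  using cone_total[of x] cone_mult[of x x] cone_mult[of "- x" "- x"] by auto

lemma cone_0: "P 0" and cone_1: "P 1"
  using cone_square[of 0] cone_square[of 1] by simp_all

lemma cone_of_nat: "P (of_nat k)"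
  by (induction k) (auto intro: cone_0 cone_1 cone_add)

lemma cone_inverse: "P x \<Longrightarrow> P (inverse x)"
  using cone_mult[of x "inverse x * inverse x"] cone_square[of "inverse x"]
  by (cases "x = 0") (auto simp: field_simps cone_0)

lemma cone_half: "P (x + x) \<Longrightarrow> P x"
  using cone_total[of x] cone_add[of "x + x" "- x"] by auto

lemma cone_of_nat_eq_0: "of_nat k = (0::'a) \<longleftrightarrow> k = 0"
proof (cases k)
  case (Suc m)
  have "of_nat k \<noteq> (0::'a)"
  proof
    assume "of_nat k = (0::'a)"
    then have "of_nat m = (- 1::'a)" unfolding Suc by (simp add: eq_neg_iff_add_eq_0 add.commute)
    then have "P (- 1)" using cone_of_nat[of m] by simp
    then show False using cone_antisym[OF cone_1] by simp
  qed
  then show ?thesis using Suc by simp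
qed simp

lemma cone_bernoulli:
  assumes "P c"
  shows "P ((1 + c) ^ k - (1 + of_nat k * c))"
proof (induction k)
  case (Suc k)
  \<comment> \<open>Multiplying the difference for \<open>k\<close> by \<open>1 + c\<close> and
    adding the square term gives exactly the difference for \<open>Suc k\<close>.\<close>
  have "P (((1 + c) ^ k - (1 + of_nat k * c)) * (1 + c) + of_nat k * (c * c))"
    by (intro cone_add cone_mult cone_square cone_of_nat cone_1 Suc assms)
  then show ?case by (simp add: algebra_simps)
qed (simp add: cone_0)

text \<open>The two sums in the proof are twice \<open>a * b - x * y\<close> and twice
  \<open>a * b + x * y\<close>; they replace a case distinction on signs.\<close>

lemma cone_interval_mult:
  assumes "P (a - x)" "P (a + x)" "P (b - y)" "P (b + y)"
  shows "P (a * b - x * y)" "P (a * b + x * y)"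
proof -
  have "P ((a - x) * (b + y) + (a + x) * (b - y))"
    by (intro cone_add[OF cone_mult cone_mult] assms)
  then show "P (a * b - x * y)"
    using cone_half[of "a * b - x * y"] by (simp add: algebra_simps)
  have "P ((a - x) * (b - y) + (a + x) * (b + y))"
    by (intro cone_add[OF cone_mult cone_mult] assms)
  then show "P (a * b + x * y)"
    using cone_half[of "a * b + x * y"] by (simp add: algebra_simps)
qed

end

section \<open>Closure properties of the sets of a locality\<close>

lemma Oset_total:
  assumes v: "v \<in> localities"
  shows "x \<in> Oset v \<or> inverse x \<in> Oset v"
  using Mset_eq_if_locality[OF v] Mset_subset_Oset[OF v] by blast

lemma Oset_1: "v \<in> localities \<Longrightarrow> 1 \<in> Oset v"
  and Oset_minus_1: "v \<in> localities \<Longrightarrow> - 1 \<in> Oset v"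
  and Oset_0: "v \<in> localities \<Longrightarrow> 0 \<in> Oset v"
  using Oset_total[of v 1] Oset_total[of v "- 1"] Oset_total[of v 0] by simp_all

lemma Oset_mult:
  fixes v :: "'a::field locality"
  assumes v: "v \<in> localities" and xy: "x \<in> Oset v" "y \<in> Oset v"
  shows "x * y \<in> Oset v"
proof -
  consider "v \<in> val_localities" | "v \<in> ord_localities" | f where "absolute_value f" "v = locality_of_abs f"
    using v by (auto simp: localities_def abs_localities_def)
  then show ?thesis
  proof cases
    case 1
    from valuation_subring_mult[OF valuation_subring_Oset_val[OF this] xy] show ?thesis .
  next
    case 2
    then obtain P where "positive_cone P" "Oset v = {x. P (1 - x) \<and> P (1 + x)}"
      by (rule ord_locality_positive_cone)
    then show ?thesis using xy cone_interval_mult[of P 1 x 1 y] by auto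
  next
    case 3
    then show ?thesis
      using xy absolute_valueD(1,3)[OF 3(1)] by (simp add: Oset_abs mult_le_one)
  qed
qed

lemma Oset_uminus: "v \<in> localities \<Longrightarrow> x \<in> Oset v \<Longrightarrow> - x \<in> Oset v"
  using Oset_mult[OF _ Oset_minus_1, of v x] by simp

lemma Oset_power: "v \<in> localities \<Longrightarrow> x \<in> Oset v \<Longrightarrow> x ^ k \<in> Oset v"
  by (induction k) (simp_all add: Oset_1 Oset_mult)

lemma Mset_iff: "v \<in> localities \<Longrightarrow> x \<in> Mset v \<longleftrightarrow> x = 0 \<or> inverse x \<notin> Oset v"
  using Mset_eq_if_locality by blast

lemma Mset_mult:
  assumes v: "v \<in> localities" and xy: "x \<in> Oset v" "y \<in> Mset v"
  shows "x * y \<in> Mset v"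
proof (cases "x = 0 \<or> y = 0")
  case False
  then have "x * inverse (x * y) = inverse y" by simp
  then show ?thesis
    using False xy Oset_mult[OF v xy(1), of "inverse (x * y)"] Mset_iff[OF v] by metis
qed (auto simp: Mset_iff[OF v])

lemma sit_set_subset: "v \<in> localities \<Longrightarrow> sit_set sit v \<subseteq> Oset v"
  by (cases sit) (auto dest: Mset_subset_Oset)

lemma sit_set_mult:
  "v \<in> localities \<Longrightarrow> x \<in> Oset v \<Longrightarrow> y \<in> sit_set sit v \<Longrightarrow> x * y \<in> sit_set sit v"
  by (cases sit) (auto intro: Oset_mult Mset_mult)

lemma Mset_subset_sit_set: "v \<in> localities \<Longrightarrow> Mset v \<subseteq> sit_set sit v"
  by (cases sit) (auto dest: Mset_subset_Oset)

lemma zero_mem_sit_set: "v \<in> localities \<Longrightarrow> 0 \<in> sit_set sit v"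
  using Mset_subset_sit_set zero_mem_Mset by blast

text \<open>For an ordering this yields the elements bounded by some integer, the smallest valuation
  ring above \<open>Oset v\<close>; a valuation ring is left unchanged.\<close>

definition nat_multiples :: "'a::field set \<Rightarrow> 'a set" where
  "nat_multiples A = {of_nat k * x | k x. x \<in> A}"

lemma subset_nat_multiples: "A \<subseteq> nat_multiples A"
proof
  fix x assume "x \<in> A"
  then have "of_nat 1 * x \<in> nat_multiples A" unfolding nat_multiples_def by blast
  then show "x \<in> nat_multiples A" by simp
qed

lemma nat_multiples_subset:
  assumes "valuation_subring R" "A \<subseteq> R"
  shows "nat_multiples A \<subseteq> R"
  using assms valuation_subring_mult[OF assms(1)] valuation_subring_of_nat[OF assms(1)]
  by (auto simp: nat_multiples_def)

lemma nat_multiples_valuation_subring: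
  "valuation_subring R \<Longrightarrow> nat_multiples R = R"
  using nat_multiples_subset[of R R] subset_nat_multiples by blast

lemma valuation_subring_nat_multiples:
  fixes v :: "'a::field locality"
  assumes v: "v \<in> val_localities \<union> ord_localities"
  shows "valuation_subring (nat_multiples (Oset v))"
proof (cases "v \<in> val_localities")
  case True
  from valuation_subring_Oset_val[OF this] show ?thesis
    by (simp add: nat_multiples_valuation_subring)
next
  case False
  with v have "v \<in> ord_localities" by blast
  then obtain P where P: "positive_cone P" and O: "Oset v = {x. P (1 - x) \<and> P (1 + x)}"
    by (rule ord_locality_positive_cone)
  have L: "v \<in> localities" using v by (auto simp: localities_def)
  \<comment> \<open>Membership means being bounded by an integer; bounds add for differences and
    multiply for products.\<close>
  have R: "x \<in> nat_multiples (Oset v) \<longleftrightarrow> (\<exists>k. P (of_nat k - x) \<and> P (of_nat k + x))" for x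
  proof
    assume "x \<in> nat_multiples (Oset v)"
    then obtain k y where y: "x = of_nat k * y" "y \<in> Oset v" by (auto simp: nat_multiples_def)
    then have "P (of_nat k * (1 - y))" "P (of_nat k * (1 + y))"
      by (simp_all add: O cone_mult[OF P cone_of_nat[OF P]])
    then show "\<exists>k. P (of_nat k - x) \<and> P (of_nat k + x)"
      using y(1) by (intro exI[of _ k]) (simp add: algebra_simps)
  next
    assume "\<exists>k. P (of_nat k - x) \<and> P (of_nat k + x)"
    then obtain k where k: "P (of_nat k - x)" "P (of_nat k + x)" by blast
    show "x \<in> nat_multiples (Oset v)"
    proof (cases "k = 0")
      case True
      then have "x = 0" using k cone_antisym[OF P, of x] by simp
      then show ?thesis using subsetD[OF subset_nat_multiples Oset_0[OF L]] by simp
    next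
      case False
      then have nz: "of_nat k \<noteq> (0::'a)" by (simp add: cone_of_nat_eq_0[OF P])
      note inv = cone_inverse[OF P cone_of_nat[OF P, of k]]
      have "1 - x / of_nat k = (of_nat k - x) * inverse (of_nat k)"
        "1 + x / of_nat k = (of_nat k + x) * inverse (of_nat k)"
        using nz by (simp_all add: divide_inverse distrib_right left_diff_distrib)
      then have "x / of_nat k \<in> Oset v"
        using cone_mult[OF P k(1) inv] cone_mult[OF P k(2) inv] unfolding O mem_Collect_eq by metis
      then have "of_nat k * (x / of_nat k) \<in> nat_multiples (Oset v)"
        unfolding nat_multiples_def by blast
      then show ?thesis using nz by simp
    qed
  qed
  have "x - y \<in> nat_multiples (Oset v) \<and> x * y \<in> nat_multiples (Oset v)"
    if xy: "x \<in> nat_multiples (Oset v)" "y \<in> nat_multiples (Oset v)" for x y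
  proof -
    obtain k l where kl: "P (of_nat k - x)" "P (of_nat k + x)" "P (of_nat l - y)" "P (of_nat l + y)"
      using xy R by blast
    have "P (of_nat (k + l) - (x - y))"
      using cone_add[OF P kl(1,4)] by (simp add: algebra_simps)
    moreover have "P (of_nat (k + l) + (x - y))"
      using cone_add[OF P kl(2,3)] by (simp add: algebra_simps)
    moreover have "P (of_nat (k * l) - x * y)" "P (of_nat (k * l) + x * y)"
      using cone_interval_mult[OF P kl] by simp_all
    ultimately show ?thesis using R by blast
  qed
  moreover have "x \<in> nat_multiples (Oset v) \<or> inverse x \<in> nat_multiples (Oset v)" for x
    using Oset_total[OF L, of x] subset_nat_multiples[of "Oset v"] by blast
  ultimately show ?thesis by (simp add: valuation_subring_def)
qed

section \<open>Finest common coarsenings\<close>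

text \<open>The element is \<open>a / b\<close>, for witnesses \<open>a\<close> and \<open>b\<close>
  of the two noninclusions: \<open>inverse b\<close> is in \<open>Mset v\<close> and
  \<open>inverse a\<close> in \<open>Mset w\<close>, and multiplying by \<open>a\<close> resp.
  \<open>b\<close> keeps them there.\<close>

lemma incomparable_obtains:
  assumes v: "v \<in> localities" and w: "w \<in> localities" and "incomparable v w"
  obtains y where "y \<noteq> 0" "y \<in> Mset v" "inverse y \<in> Mset w"
proof -
  obtain a b where ab: "a \<in> Oset v" "a \<notin> Oset w" "b \<in> Oset w" "b \<notin> Oset v"
    using assms(3) by (auto simp: incomparable_def refines_def)
  have "inverse b \<in> Mset v" "inverse a \<in> Mset w"
    using ab by (auto simp: Mset_iff[OF v] Mset_iff[OF w])
  then have "a * inverse b \<in> Mset v" "b * inverse a \<in> Mset w"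
    using ab Mset_mult[OF v] Mset_mult[OF w] by blast+
  moreover have "a \<noteq> 0" "b \<noteq> 0"
    using ab Oset_0[OF v] Oset_0[OF w] by auto
  ultimately show ?thesis
    by (intro that[of "a * inverse b"]) (simp_all add: mult.commute)
qed

text \<open>Condition (iv) of the uniformity assumption, multiplied by \<open>t\<close>; it replaces
  closure under addition.\<close>

definition add_bounded :: "'a::field \<Rightarrow> 'a locality \<Rightarrow> bool" where
  "add_bounded t v \<longleftrightarrow> (\<forall>a\<in>Oset v. \<forall>b\<in>Oset v. t * (a + b) \<in> Oset v)"

lemma add_boundedD: "add_bounded t v \<Longrightarrow> a \<in> Oset v \<Longrightarrow> b \<in> Oset v \<Longrightarrow> t * (a + b) \<in> Oset v"
  by (simp add: add_bounded_def)

text \<open>Taking out the larger summand, say \<open>y\<close>, leaves the factor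
  \<open>t * (x / y + 1)\<close>, which is in \<open>Oset v\<close>.\<close>

lemma Mset_add:
  assumes v: "v \<in> localities" and "add_bounded t v"
    and xy: "x \<in> Mset v" "y \<in> Mset v"
  shows "t * (x + y) \<in> Mset v"
proof -
  note t = add_boundedD[OF assms(2)]
  have t_mem: "t \<in> Oset v" using t[OF Oset_1[OF v] Oset_0[OF v]] by simp
  consider "x = 0" | "y = 0" | "x \<noteq> 0" "y \<noteq> 0" "x / y \<in> Oset v" | "x \<noteq> 0" "y \<noteq> 0" "y / x \<in> Oset v"
    using Oset_total[OF v, of "x / y"] by fastforce
  then show ?thesis
  proof cases
    case 3
    then have "t * (x / y + 1) * y \<in> Mset v"
      using Mset_mult[OF v t[OF _ Oset_1[OF v]] xy(2)] by blast
    moreover have "t * (x / y + 1) * y = t * (x + y)" using 3 by (simp add: field_simps)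
    ultimately show ?thesis by metis
  next
    case 4
    then have "t * (y / x + 1) * x \<in> Mset v"
      using Mset_mult[OF v t[OF _ Oset_1[OF v]] xy(1)] by blast
    moreover have "t * (y / x + 1) * x = t * (x + y)" using 4 by (simp add: field_simps)
    ultimately show ?thesis by metis
  qed (use Mset_mult[OF v t_mem] xy in simp_all)
qed

lemma Mset_uminus: "v \<in> localities \<Longrightarrow> x \<in> Mset v \<Longrightarrow> - x \<in> Mset v"
  using Mset_mult[OF _ Oset_minus_1, of v x] by simp

text \<open>A valuation ring is \<open>add_bounded\<close> with constant 1, so \<open>Mset u\<close>
  is closed under sums.\<close>

lemma coset_Mset_eqI:
  assumes u: "u \<in> localities" "valuation_subring (Oset u)" and xy: "x - y \<in> Mset u"
  shows "x +o Mset u = y +o Mset u"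
proof -
  have add: "a + b \<in> Mset u" if "a \<in> Mset u" "b \<in> Mset u" for a b
    using Mset_add[OF u(1), of 1 a b] that valuation_subring_add[OF u(2)] by (simp add: add_bounded_def)
  have coset_subset: "x +o Mset u \<subseteq> y +o Mset u" if xy: "x - y \<in> Mset u" for x y
  proof
    fix a assume "a \<in> x +o Mset u"
    then obtain b where "b \<in> Mset u" "a = x + b" by (auto simp: elt_set_plus_def)
    then have "(x - y) + b \<in> Mset u" "a = y + ((x - y) + b)" using xy add by simp_all
    then show "a \<in> y +o Mset u" unfolding elt_set_plus_def by blast
  qed
  have "y - x \<in> Mset u" using Mset_uminus[OF u(1) xy] by simp
  then show ?thesis using coset_subset xy by blast
qed

lemma times_Oset_subset:
  assumes "u \<in> localities" "refines v u" "refines w u"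
  shows "Oset v * Oset w \<subseteq> Oset u"
  using assms Oset_mult[OF assms(1)] by (auto simp: refines_def elim!: set_times_elim)

lemma refines_times:
  assumes "v \<in> localities" "w \<in> localities" "Oset u = Oset v * Oset w"
  shows "refines v u" "refines w u"
  using set_times_intro[OF _ Oset_1[OF assms(2)]] set_times_intro[OF Oset_1[OF assms(1)]]
  by (force simp: refines_def assms(3))+

text \<open>The set of any common coarsening is closed under products, hence contains
  \<open>Oset v * Oset w\<close>; this set is therefore minimal as soon as it belongs to a
  locality.\<close>

lemma finest_common_coarsening_times:
  assumes "v \<in> localities" "w \<in> localities" "u \<in> localities" "Oset u = Oset v * Oset w"
  shows "finest_common_coarsening v w u"
  unfolding finest_common_coarsening_def
  using assms(3) refines_times[OF assms(1,2,4)] times_Oset_subset[of _ v w]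
  by (auto simp: refines_def assms(4))

text \<open>Powers of \<open>y\<close> shrink any \<open>x\<close> into the unit ball, while the
  powers of \<open>inverse y\<close> that undo this stay in \<open>Oset w\<close>.\<close>

lemma times_Oset_abs:
  assumes f: "absolute_value f" and w: "w \<in> localities"
    and y: "y \<noteq> 0" "y \<in> Mset (locality_of_abs f)" "inverse y \<in> Oset w"
  shows "Oset (locality_of_abs f) * Oset w = UNIV"
proof -
  have "x \<in> Oset (locality_of_abs f) * Oset w" for x
  proof -
    have nonneg: "f x \<ge> 0" using absolute_valueD(1)[OF f] .
    \<comment> \<open>The bound \<open>1 / (1 + f x)\<close>, unlike \<open>1 / f x\<close>, also
      covers \<open>x = 0\<close>.\<close>
    obtain k where k: "f y ^ k < 1 / (1 + f x)"
      using real_arch_pow_inv[of "1 / (1 + f x)" "f y"] y(2) nonneg by (auto simp: Mset_of_abs)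
    have "f y ^ k * f x \<le> 1 / (1 + f x) * f x"
      using k nonneg by (intro mult_right_mono) auto
    also have "\<dots> \<le> 1" using nonneg by (simp add: field_simps)
    finally have "y ^ k * x \<in> Oset (locality_of_abs f)"
      by (simp add: Oset_abs absolute_valueD(3)[OF f] absolute_value_power[OF f])
    from set_times_intro[OF this Oset_power[OF w y(3), of k]] show ?thesis
      using y(1) by (simp add: field_simps)
  qed
  then show ?thesis by blast
qed

section \<open>Two orderings: integers in the product of their unit intervals\<close>

lemma cone_ratio:
  assumes P: "positive_cone P" and "P x" "P (y - x)"
  shows "P (1 - x / y)" "P (1 + x / y)"
proof -
  have "P y" using cone_add[OF P assms(2,3)] by simp
  note inv = cone_inverse[OF P this]
  show "P (1 + x / y)"
    unfolding divide_inverse by (intro cone_add[OF P] cone_1[OF P] cone_mult[OF P] assms inv)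
  show "P (1 - x / y)"
  proof (cases "y = 0")
    case False
    then show ?thesis
      using cone_mult[OF P assms(3) inv] by (simp add: left_diff_distrib divide_inverse)
  qed (simp add: cone_1[OF P])
qed

text \<open>
  If \<open>u\<close> is an absolute value, take \<open>a = 1 + c\<close> in \<open>Oset v\<close> with \<open>a > 1\<close> in the ordering \<open>w\<close>. Bernoulli's
  inequality puts \<open>(1 + k c) / a ^ k\<close> into \<open>Oset u\<close>, which bounds the integers, so that the absolute value is
  nonarchimedean.
\<close>

lemma of_nat_mem_common_coarsening:
  assumes v: "v \<in> ord_localities" and w: "w \<in> ord_localities" and vw: "incomparable v w"
    and u: "u \<in> localities" "refines v u" "refines w u"
  shows "of_nat n \<in> Oset u"
proof -
  have vL: "v \<in> localities" and wL: "w \<in> localities"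
    using v w by (auto simp: localities_def)
  obtain P where P: "positive_cone P" and O: "Oset w = {x. P (1 - x) \<and> P (1 + x)}"
    using w by (rule ord_locality_positive_cone)
  consider "u \<in> val_localities" | "u \<in> ord_localities"
    | g where "absolute_value g" "u = locality_of_abs g"
    using u(1) by (auto simp: localities_def abs_localities_def)
  then show ?thesis
  proof cases
    case 1
    show ?thesis by (rule valuation_subring_of_nat[OF valuation_subring_Oset_val[OF 1]])
  next
    case 2
    then obtain Q where Q: "positive_cone Q" and OQ: "Oset u = {x. Q (1 - x) \<and> Q (1 + x)}"
      by (rule ord_locality_positive_cone)
    \<comment> \<open>No ordering coarsens both: \<open>y\<close> and \<open>inverse y\<close> would
      lie between -1 and 1 for \<open>Q\<close>, forcing \<open>y * y = 1\<close>, but 1 and -1 are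
      not in \<open>Mset v\<close>.\<close>
    obtain y where y: "y \<noteq> 0" "y \<in> Mset v" "inverse y \<in> Mset w"
      using incomparable_obtains[OF vL wL vw] .
    have "y \<in> Oset u" "inverse y \<in> Oset u"
      using y u(2,3) Mset_subset_Oset[OF vL] Mset_subset_Oset[OF wL] by (auto simp: refines_def)
    then have "Q (1 - y * y)" "Q (1 - inverse y * inverse y)"
      using cone_interval_mult(1)[OF Q, of 1 y 1 y]
        cone_interval_mult(1)[OF Q, of 1 "inverse y" 1 "inverse y"] by (auto simp: OQ)
    moreover have "(1 - inverse y * inverse y) * (y * y) = - (1 - y * y)"
      using y(1) by (simp add: field_simps)
    ultimately have "1 - y * y = 0"
      using cone_antisym[OF Q, of "1 - y * y"] cone_mult[OF Q _ cone_square[OF Q], of _ y] by metis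
    then have "y = 1 \<or> y = - 1"
      by (metis eq_iff_diff_eq_0 square_eq_1_iff)
    then show ?thesis
      using y Oset_1[OF vL] Oset_minus_1[OF vL] by (auto simp: Mset_iff[OF vL])
  next
    case 3
    note g = absolute_valueD[OF 3(1)]
    obtain a where a: "a \<in> Oset v" "a \<notin> Oset w" "P (a - 1)"
    proof -
      obtain a where a: "a \<in> Oset v" "a \<notin> Oset w"
        using vw by (auto simp: incomparable_def refines_def)
      then consider "\<not> P (1 - a)" | "\<not> P (1 + a)" by (auto simp: O)
      then show ?thesis
      proof cases
        case 1
        then have "P (a - 1)" using cone_total[OF P, of "1 - a"] by simp
        with a show ?thesis by (rule that)
      next
        case 2
        then have "P (- (1 + a))" using cone_total[OF P] by blast
        moreover have "- (1 + a) = - a - 1" by algebra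
        ultimately have "P (- a - 1)" by metis
        moreover have "- a \<notin> Oset w" using a(2) Oset_uminus[OF wL, of "- a"] by auto
        ultimately show ?thesis using that[OF Oset_uminus[OF vL a(1)]] by simp
      qed
    qed
    define c where "c = a - 1"
    have c: "c \<noteq> 0" "P c" "1 + c = a" using a Oset_1[OF wL] by (auto simp: c_def)
    have a0: "a \<noteq> 0" using a(2) Oset_0[OF wL] by auto
    have ga: "g a \<le> 1" using a(1) u(2) by (auto simp: refines_def 3(2) Oset_abs)
    \<comment> \<open>The 2 is 1 for \<open>1 + of_nat k * c\<close>, whose value is at most that of
      \<open>a ^ k\<close>, plus 1 for the subtracted 1.\<close>
    have bounded: "g (of_nat k) \<le> 2 / g c" for k
    proof -
      have "P (1 + of_nat k * c)"
        by (intro cone_add[OF P] cone_1[OF P] cone_mult[OF P] cone_of_nat[OF P] c)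
      then have "(1 + of_nat k * c) / a ^ k \<in> Oset w"
        using cone_ratio[OF P _ cone_bernoulli[OF P c(2)], of k] by (simp add: O c(3))
      then have "g ((1 + of_nat k * c) / a ^ k) \<le> 1"
        using u(3) by (auto simp: refines_def 3(2) Oset_abs)
      then have "g ((1 + of_nat k * c) / a ^ k) * g (a ^ k) \<le> 1 * 1"
        using ga g(1) by (intro mult_mono) (auto simp: absolute_value_power[OF 3(1)] power_le_one)
      moreover have "g ((1 + of_nat k * c) / a ^ k) * g (a ^ k) = g (1 + of_nat k * c)"
        using a0 by (simp flip: g(3))
      ultimately have "g (of_nat k * c) \<le> 2"
        using g(4)[of "1 + of_nat k * c" "- 1"] absolute_value_1[OF 3(1)]
          absolute_value_uminus[OF 3(1), of 1] by simp
      then have "g (of_nat k) * g c \<le> 2" by (simp add: g(3))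
      moreover have "g c > 0" using c(1) g(1,2)[of c] by (simp add: less_le)
      ultimately show ?thesis by (simp add: pos_le_divide_eq)
    qed
    \<comment> \<open>Powers of an integer are integers, so a value above 1 would contradict the
      uniform bound.\<close>
    have "g (of_nat n) \<le> 1"
    proof (rule ccontr)
      assume "\<not> g (of_nat n) \<le> 1"
      then obtain m where "2 / g c < g (of_nat n) ^ m" using real_arch_pow by fastforce
      moreover have "g (of_nat n) ^ m = g (of_nat (n ^ m))"
        by (simp add: absolute_value_power[OF 3(1)])
      ultimately show False using bounded[of "n ^ m"] by simp
    qed
    then show ?thesis by (simp add: 3(2) Oset_abs)
  qed
qed

text \<open>In \<open>v\<close> the size of \<open>z\<close> exceeds every integer, so
  \<open>of_nat n / z\<close> is in \<open>Oset v\<close>; multiplying by \<open>z\<close> returns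
  the integer.\<close>

lemma of_nat_mem_times_Oset:
  assumes v: "v \<in> localities" and w: "w \<in> localities"
    and z: "z \<in> Oset w" "z \<notin> nat_multiples (Oset v)"
  shows "of_nat n \<in> Oset v * Oset w"
proof (cases "of_nat n = (0::'a)")
  case True
  then show ?thesis using set_times_intro[OF Oset_0[OF v] Oset_0[OF w]] by simp
next
  case False
  have "z / of_nat n \<notin> Oset v"
  proof
    assume "z / of_nat n \<in> Oset v"
    then have "of_nat n * (z / of_nat n) \<in> nat_multiples (Oset v)"
      unfolding nat_multiples_def by blast
    then show False using z(2) False by simp
  qed
  then have "of_nat n / z \<in> Oset v" using Oset_total[OF v, of "z / of_nat n"] by simp
  from set_times_intro[OF this z(1)] have "of_nat n / z * z \<in> Oset v * Oset w" .
  moreover have "z \<noteq> 0" using z(2) Oset_0[OF v] subset_nat_multiples[of "Oset v"] by auto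
  ultimately show ?thesis by simp
qed

text \<open>
  One of \<open>a\<close> and \<open>- a\<close> exceeds \<open>1\<close> by a noninfinitesimal amount in \<open>w\<close>, hence has
  powers that dominate any given integer.
\<close>

lemma of_nat_mem_times_Oset_residue:
  assumes v: "v \<in> localities" and w: "w \<in> ord_localities"
    and u: "u \<in> localities" "Oset u = nat_multiples (Oset w)"
    and a: "a \<in> Oset v" "\<And>b. b \<in> Oset w \<Longrightarrow> a - b \<notin> Mset u"
  shows "of_nat n \<in> Oset v * Oset w"
proof -
  have wL: "w \<in> localities" using w by (auto simp: localities_def)
  obtain P where P: "positive_cone P" and O: "Oset w = {x. P (1 - x) \<and> P (1 + x)}"
    using w by (rule ord_locality_positive_cone)
  obtain x where x: "x \<in> Oset v" "\<And>b. b \<in> Oset w \<Longrightarrow> x - b \<notin> Mset u" "P (x - 1)"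
  proof -
    have "a \<notin> Oset w" using a(2)[of a] zero_mem_Mset[OF u(1)] by auto
    then consider "\<not> P (1 - a)" | "\<not> P (1 + a)" by (auto simp: O)
    then show ?thesis
    proof cases
      case 1
      then have "P (a - 1)" using cone_total[OF P, of "1 - a"] by simp
      with a show ?thesis by (intro that)
    next
      case 2
      then have "P (- (1 + a))" using cone_total[OF P] by blast
        moreover have "- (1 + a) = - a - 1" by algebra
        ultimately have "P (- a - 1)" by metis
      moreover have "- a - b \<notin> Mset u" if "b \<in> Oset w" for b
        using a(2)[OF Oset_uminus[OF wL that]] Mset_uminus[OF u(1), of "- a - b"]
        by (auto simp: add.commute)
      ultimately show ?thesis using that[OF Oset_uminus[OF v a(1)]] by simp
    qed
  qed
  define c where "c = x - 1"
  have c: "P c" "1 + c = x" using x(3) by (auto simp: c_def)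
  have "c \<notin> Mset u" using x(2)[OF Oset_1[OF wL]] by (simp add: c_def)
  then have c0: "c \<noteq> 0" and "inverse c \<in> nat_multiples (Oset w)"
    by (auto simp: Mset_iff[OF u(1)] u(2))
  then obtain k y where y: "inverse c = of_nat k * y" "y \<in> Oset w"
    by (auto simp: nat_multiples_def)
  have "of_nat k * c - 1 = of_nat k * (1 - y) * c"
  proof -
    have "1 = of_nat k * y * c" using y(1) c0 by (metis left_inverse)
    then show ?thesis by (simp add: algebra_simps)
  qed
  then have kc: "P (of_nat k * c - 1)"
    using cone_mult[OF P cone_mult[OF P cone_of_nat[OF P, of k], of "1 - y"] c(1)] y(2) by (simp add: O)
  \<comment> \<open>The exponent \<open>n * k\<close> works because Bernoulli gives
    \<open>x ^ (n * k)\<close> at least \<open>1 + n * k * c\<close>, and \<open>k * c\<close> is at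
    least 1.\<close>
  have "P ((x ^ (n * k) - (1 + of_nat (n * k) * c)) + (1 + of_nat n * (of_nat k * c - 1)))"
    using cone_bernoulli[OF P c(1), of "n * k"] kc unfolding c(2)
    by (intro cone_add[OF P] cone_1[OF P] cone_mult[OF P cone_of_nat[OF P]])
  moreover have "(x ^ (n * k) - (1 + of_nat (n * k) * c)) + (1 + of_nat n * (of_nat k * c - 1)) =
    x ^ (n * k) - of_nat n"
    by (simp add: algebra_simps)
  ultimately have "P (x ^ (n * k) - of_nat n)" by metis
  then have "of_nat n / x ^ (n * k) \<in> Oset w"
    using cone_ratio[OF P cone_of_nat[OF P]] by (simp add: O)
  from set_times_intro[OF Oset_power[OF v x(1), of "n * k"] this]
  have "x ^ (n * k) * (of_nat n / x ^ (n * k)) \<in> Oset v * Oset w" .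
  moreover have "x \<noteq> 0"
    using x(2)[OF Oset_0[OF wL]] zero_mem_Mset[OF u(1)] by auto
  ultimately show ?thesis by simp
qed

text \<open>The rings of elements bounded by integers are compared. If they differ, one interval has
  an element unbounded for the other ordering. If they agree, they are the ring of the join, and the
  distinct residue localities provide an element of one interval that stays outside the other even
  modulo infinitesimals.\<close>

lemma of_nat_mem_times_Oset_ord:
  assumes v: "v \<in> ord_localities" and w: "w \<in> ord_localities" and vw: "strongly_incomparable v w"
  shows "of_nat n \<in> Oset v * Oset w"
proof -
  have vL: "v \<in> localities" and wL: "w \<in> localities"
    using v w by (auto simp: localities_def)
  have inc: "incomparable v w" using vw by (simp add: strongly_incomparable_def)
  have Rv: "valuation_subring (nat_multiples (Oset v))"
    and Rw: "valuation_subring (nat_multiples (Oset w))"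
    using valuation_subring_nat_multiples v w by blast+
  consider "\<not> Oset w \<subseteq> nat_multiples (Oset v)" | "\<not> Oset v \<subseteq> nat_multiples (Oset w)"
    | "nat_multiples (Oset v) = nat_multiples (Oset w)"
    using nat_multiples_subset[OF Rv] nat_multiples_subset[OF Rw] by blast
  then show ?thesis
  proof cases
    case 1
    then show ?thesis using of_nat_mem_times_Oset[OF vL wL] by blast
  next
    case 2
    then show ?thesis using of_nat_mem_times_Oset[OF wL vL] by (auto simp: mult.commute)
  next
    case 3
    obtain u where u: "u \<in> localities" "Oset u = nat_multiples (Oset w)"
      using valuation_subring_obtains_locality[OF Rw] .
    \<comment> \<open>For minimality, \<open>of_nat_mem_common_coarsening\<close> puts the integers
      into every common coarsening, hence all of \<open>nat_multiples (Oset w)\<close>.\<close>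
    have "finest_common_coarsening v w u"
      unfolding finest_common_coarsening_def
    proof (intro conjI ballI impI)
      show "refines v u" "refines w u"
        using 3 u(2) subset_nat_multiples by (auto simp: refines_def)
      fix u' assume u': "u' \<in> localities" "refines v u' \<and> refines w u'"
      then show "refines u u'"
        using of_nat_mem_common_coarsening[OF v w inc u'(1)] Oset_mult[OF u'(1)]
        unfolding refines_def u(2) nat_multiples_def by blast
    qed (rule u(1))
    then have "residue_Oset u v \<noteq> residue_Oset u w"
      using vw join_eqI by (metis strongly_incomparable_def)
    then consider a where "a \<in> Oset v" "a +o Mset u \<notin> residue_Oset u w"
      | a where "a \<in> Oset w" "a +o Mset u \<notin> residue_Oset u v"
      by (auto simp: residue_Oset_def)
    then show ?thesis
    proof cases
      case 1
      have "a - b \<notin> Mset u" if "b \<in> Oset w" for b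
        using 1 that coset_Mset_eqI[OF u(1), of a b] Rw u(2) by (auto simp: residue_Oset_def)
      then show ?thesis
        by (rule of_nat_mem_times_Oset_residue[OF vL w u 1(1)])
    next
      case 2
      have "a - b \<notin> Mset u" if "b \<in> Oset v" for b
        using 2 that coset_Mset_eqI[OF u(1), of a b] Rw u(2) by (auto simp: residue_Oset_def)
      then have "of_nat n \<in> Oset w * Oset v"
        using of_nat_mem_times_Oset_residue[OF wL v u(1) _ 2(1)] 3 u(2) by simp
      then show ?thesis by (simp add: mult.commute)
    qed
  qed
qed

text \<open>For valuations and orderings the left-hand factors are valuation rings; the extra
  integers are harmless once they lie in the product set itself.\<close>

lemma times_nat_multiples:
  fixes v w :: "'a::field locality"
  assumes v: "v \<in> localities" and w: "w \<in> localities"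
    and nat: "\<And>n. of_nat n \<in> Oset v * Oset w"
  shows "nat_multiples (Oset v) * nat_multiples (Oset w) = Oset v * Oset w"
proof
  show "Oset v * Oset w \<subseteq> nat_multiples (Oset v) * nat_multiples (Oset w)"
    by (intro set_times_mono2 subset_nat_multiples)
  show "nat_multiples (Oset v) * nat_multiples (Oset w) \<subseteq> Oset v * Oset w"
  proof
    fix x assume "x \<in> nat_multiples (Oset v) * nat_multiples (Oset w)"
    then obtain k l a b where x: "x = of_nat k * a * (of_nat l * b)" and ab: "a \<in> Oset v" "b \<in> Oset w"
      by (auto simp: nat_multiples_def elim!: set_times_elim)
    obtain c d where "of_nat (k * l) = c * d" "c \<in> Oset v" "d \<in> Oset w"
      using nat[of "k * l"] by (rule set_times_elim)
    moreover from this have "x = (a * c) * (b * d)" by (simp add: x mult_ac)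
    ultimately show "x \<in> Oset v * Oset w"
      using ab Oset_mult[OF v] Oset_mult[OF w] set_times_intro by metis
  qed
qed

text \<open>With an absolute value involved the product is the whole field. Otherwise it is the
  product of the two rings of integer multiples.\<close>

lemma valuation_subring_times_Oset:
  fixes v w :: "'a::field locality"
  assumes v: "v \<in> localities" and w: "w \<in> localities" and inc: "incomparable v w"
    and ord: "v \<in> ord_localities \<Longrightarrow> w \<in> ord_localities \<Longrightarrow> strongly_incomparable v w"
  shows "valuation_subring (Oset v * Oset w)"
proof -
  obtain y where y: "y \<noteq> 0" "y \<in> Mset v" "inverse y \<in> Mset w"
    using incomparable_obtains[OF v w inc] .
  consider "v \<in> abs_localities" | "w \<in> abs_localities"
    | "v \<in> val_localities \<union> ord_localities" "w \<in> val_localities \<union> ord_localities"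
    using v w by (auto simp: localities_def)
  then show ?thesis
  proof cases
    case 1
    then have "Oset v * Oset w = UNIV"
      using y times_Oset_abs[OF _ w y(1)] Mset_subset_Oset[OF w] by (auto simp: abs_localities_def)
    then show ?thesis by (simp add: valuation_subring_UNIV)
  next
    case 2
    then have "Oset w * Oset v = UNIV"
      using y times_Oset_abs[OF _ v, of _ "inverse y"] Mset_subset_Oset[OF v]
      by (auto simp: abs_localities_def)
    then show ?thesis by (simp add: valuation_subring_UNIV mult.commute)
  next
    case 3
    have "of_nat n \<in> Oset v * Oset w" for n
    proof -
      consider "v \<in> val_localities" | "w \<in> val_localities" | "v \<in> ord_localities" "w \<in> ord_localities"
        using 3 by blast
      then show ?thesis
      proof cases
        case 1
        from set_times_intro[OF valuation_subring_of_nat[OF valuation_subring_Oset_val[OF 1]] Oset_1[OF w]]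
        show ?thesis by simp
      next
        case 2
        from set_times_intro[OF Oset_1[OF v] valuation_subring_of_nat[OF valuation_subring_Oset_val[OF 2]]]
        show ?thesis by simp
      next
        case 3
        then show ?thesis using of_nat_mem_times_Oset_ord ord by blast
      qed
    qed
    from times_nat_multiples[OF v w this] show ?thesis
      using valuation_subring_times[OF valuation_subring_nat_multiples valuation_subring_nat_multiples, OF 3]
      by simp
  qed
qed

section \<open>Independent pairs of localities\<close>

lemma Ounits_inverse:
  assumes "u \<in> localities" "t \<in> Ounits u"
  shows "inverse t \<in> Oset u"
  using assms by (auto simp: Ounits_def Mset_iff)

text \<open>For a comparable pair the join is the coarser locality, where the unit \<open>t\<close>
  can be cancelled from \<open>add_bounded\<close>, leaving closure under sums. Otherwise the join
  has the product set as its ring.\<close>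

lemma independent_at_cases:
  fixes v w :: "'a::field locality"
  assumes v: "v \<in> localities" and w: "w \<in> localities" and ind: "independent_at t v w"
    and tv: "add_bounded t v" and tw: "add_bounded t w"
  obtains "refines v w" "valuation_subring (Oset w)" "inverse t \<in> Oset w"
  | "refines w v" "valuation_subring (Oset v)" "inverse t \<in> Oset v"
  | "incomparable v w" "valuation_subring (Oset v * Oset w)" "inverse t \<in> Oset v * Oset w"
proof -
  have t: "t \<in> Ounits (join v w)" using ind by (simp add: independent_at_def)
  have sub: "valuation_subring (Oset u)"
    if u: "u \<in> localities" "t \<in> Ounits u"
      and tu: "add_bounded t u" for u
  proof -
    have "t \<noteq> 0" using u by (auto simp: Ounits_def Mset_iff)
    have "a - b \<in> Oset u" if ab: "a \<in> Oset u" "b \<in> Oset u" for a b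
    proof -
      have "inverse t * (t * (a + - b)) \<in> Oset u"
        using Oset_mult[OF u(1) Ounits_inverse[OF u] add_boundedD[OF tu ab(1) Oset_uminus[OF u(1) ab(2)]]] .
      then show ?thesis using \<open>t \<noteq> 0\<close> by (simp flip: mult.assoc)
    qed
    then show ?thesis
      using Oset_mult[OF u(1)] Oset_total[OF u(1)] by (simp add: valuation_subring_def)
  qed
  consider "refines v w" | "refines w v" | "incomparable v w"
    by (auto simp: incomparable_def)
  then show ?thesis
  proof cases
    case 1
    then have "join v w = w"
      using w by (intro join_eqI) (auto simp: finest_common_coarsening_def refines_def)
    then show ?thesis using that(1)[OF 1 sub[OF w _ tw]] t Ounits_inverse[OF w] by metis
  next
    case 2
    then have "join v w = v"
      using v by (intro join_eqI) (auto simp: finest_common_coarsening_def refines_def)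
    then show ?thesis using that(2)[OF 2 sub[OF v _ tv]] t Ounits_inverse[OF v] by metis
  next
    case 3
    have R: "valuation_subring (Oset v * Oset w)"
      using valuation_subring_times_Oset[OF v w 3] ind by (simp add: independent_at_def)
    obtain u where u: "u \<in> localities" "Oset u = Oset v * Oset w"
      using valuation_subring_obtains_locality[OF R] .
    have "join v w = u" by (rule join_eqI[OF finest_common_coarsening_times[OF v w u]])
    then show ?thesis using that(3)[OF 3 R] t Ounits_inverse[OF u(1)] u(2) by metis
  qed
qed

text \<open>Lets powers of \<open>t\<close> be absorbed into precisions: if \<open>inverse c\<close>
  is in every such \<open>R\<close>, so is the inverse of \<open>t * c\<close>.\<close>

lemma independent_at_inverse_mem:
  fixes v w :: "'a::field locality"
  assumes v: "v \<in> localities" and w: "w \<in> localities" and ind: "independent_at t v w"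
    and tv: "add_bounded t v" and tw: "add_bounded t w"
    and R: "valuation_subring R" "Oset v \<subseteq> R" "Oset w \<subseteq> R"
  shows "inverse t \<in> R"
  using v w ind tv tw
proof (cases rule: independent_at_cases)
  case 3
  then show ?thesis
    using subsetD[OF R(2)] subsetD[OF R(3)] valuation_subring_mult[OF R(1)]
    by (auto elim!: set_times_elim)
qed (use R in auto)

text \<open>A comparable pair occurs only for \<open>Sit_O\<close>, where 1 counts as small and
  \<open>c\<close> or \<open>inverse d\<close> itself serves. For an incomparable pair the ring
  hypothesis applies to the product set and factors the inverse precisions.\<close>

lemma independent_at_separation:
  fixes v w :: "'a::field locality"
  assumes v: "v \<in> localities" and w: "w \<in> localities" and ind: "independent_at t v w"
    and tv: "add_bounded t v" and tw: "add_bounded t w"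
    and inc: "sit = Sit_m \<Longrightarrow> incomparable v w"
    and cd: "c \<noteq> 0" "d \<noteq> 0"
    and R: "\<And>R. valuation_subring R \<Longrightarrow> Oset v \<subseteq> R \<Longrightarrow> Oset w \<subseteq> R \<Longrightarrow> inverse c \<in> R \<and> inverse d \<in> R"
  obtains y where "y \<noteq> 0" "y / c \<in> sit_set sit v" "inverse y / d \<in> sit_set sit w"
  using v w ind tv tw
proof (cases rule: independent_at_cases)
  case 1
  then have "inverse c \<in> Oset w" "inverse d \<in> Oset w"
    using R[of "Oset w"] by (auto simp: refines_def)
  moreover have "sit = Sit_O" using 1(1) inc by (cases sit) (auto simp: incomparable_def)
  ultimately show ?thesis
    using that[of c] cd Oset_1[OF v] Oset_mult[OF w] by (simp add: divide_inverse)
next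
  case 2
  then have "inverse c \<in> Oset v" "inverse d \<in> Oset v"
    using R[of "Oset v"] by (auto simp: refines_def)
  moreover have "sit = Sit_O" using 2(1) inc by (cases sit) (auto simp: incomparable_def)
  ultimately show ?thesis
    using that[of "inverse d"] cd Oset_1[OF w] Oset_mult[OF v, of "inverse d" "inverse c"]
    by (simp add: divide_inverse)
next
  case 3
  have "Oset v \<subseteq> Oset v * Oset w" "Oset w \<subseteq> Oset v * Oset w"
    using set_times_intro[OF _ Oset_1[OF w]] set_times_intro[OF Oset_1[OF v]] by force+
  then obtain a b a' b' where ab: "inverse c = a * b" "inverse d = a' * b'"
    and mem: "a \<in> Oset v" "b \<in> Oset w" "a' \<in> Oset v" "b' \<in> Oset w"
    using R[OF 3(2)] by (meson set_times_elim)
  obtain y where y: "y \<noteq> 0" "y \<in> Mset v" "inverse y \<in> Mset w"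
    using incomparable_obtains[OF v w 3(1)] .
  have nz: "a \<noteq> 0" "b \<noteq> 0" "a' \<noteq> 0" "b' \<noteq> 0" using ab cd by auto
  \<comment> \<open>The correction \<open>a' / b\<close> makes \<open>z / c\<close> collect the
    factors from \<open>Oset v\<close> and \<open>inverse z / d\<close> those from
    \<open>Oset w\<close>; \<open>y\<close> adds strict smallness.\<close>
  define z where "z = y * (a' / b)"
  have "z / c = (a * a') * y" "inverse z / d = (b * b') * inverse y"
    using nz y(1) by (simp_all add: z_def divide_inverse ab)
  moreover have "(a * a') * y \<in> Mset v" "(b * b') * inverse y \<in> Mset w"
    using Mset_mult[OF v Oset_mult[OF v] y(2)] Mset_mult[OF w Oset_mult[OF w] y(3)] mem by blast+
  ultimately show ?thesis
    using that[of z] y(1) nz Mset_subset_sit_set[OF v] Mset_subset_sit_set[OF w]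
    by (auto simp: z_def)
qed

section \<open>Localities with a uniform polynomial\<close>

lemma openin_sit_set:
  "openin (sit_topology sit) {v \<in> localities. x \<in> sit_set sit v}"
  by (cases sit) (auto simp: zariski_def zariski_star_def intro!: topology_generated_by_Basis)

text \<open>Finitely many parameters, not open sets, are returned, since the parameters are field
  elements to be combined.\<close>

lemma compactin_finite_cover:
  assumes C: "compactin X C" and U: "\<And>y. openin X (U y)"
    and cover: "\<forall>v\<in>C. \<exists>y. Q y \<and> v \<in> U y"
  shows "\<exists>Y. finite Y \<and> (\<forall>y\<in>Y. Q y) \<and> C \<subseteq> (\<Union>y\<in>Y. U y)"
proof -
  have "\<forall>V\<in>U ` Collect Q. openin X V" "C \<subseteq> \<Union>(U ` Collect Q)"
    using U cover by blast+
  then obtain F where F: "finite F" "F \<subseteq> U ` Collect Q" "C \<subseteq> \<Union>F"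
    using C unfolding compactin_def by meson
  obtain Y where "Y \<subseteq> Collect Q" "finite Y" "F = U ` Y"
    using finite_subset_image[OF F(1,2)] by blast
  then show ?thesis using F(3) by (intro exI[of _ Y]) auto
qed

locale uniform_localities =
  fixes S :: "'a::field locality set" and t :: 'a and f :: "'a poly" and sit :: situation
  assumes S_subset: "S \<subseteq> localities" and t_nonzero: "t \<noteq> 0" and degree_f: "degree f \<ge> 2"
    and uniform: "\<And>v. v \<in> S \<Longrightarrow>
      (\<forall>x \<in> Oset v. poly f x \<in> Oset v) \<and>
      (\<forall>x \<in> Oset v. poly f x \<notin> t *o Mset v) \<and>
      (\<forall>x \<in> - Oset v.
         poly f x \<in> (x ^ degree f) *o (Oset v - t *o Mset v) \<inter>
           ((lead_coeff f * x ^ degree f) +o ((x ^ (degree f - 1)) *o Oset v))) \<and>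
      Oset v + Oset v \<subseteq> inverse t *o Oset v"
begin

abbreviation "B \<equiv> sit_set sit"

lemma locality: "v \<in> S \<Longrightarrow> v \<in> localities"
  using S_subset by blast

lemmas O_mult = Oset_mult[OF locality]
  and O_power = Oset_power[OF locality]
  and O_total = Oset_total[OF locality]
  and O_1 = Oset_1[OF locality]
  and O_uminus = Oset_uminus[OF locality]

lemma B_subset: "v \<in> S \<Longrightarrow> y \<in> B v \<Longrightarrow> y \<in> Oset v"
  using sit_set_subset[OF locality] by blast

lemma B_0: "v \<in> S \<Longrightarrow> 0 \<in> B v"
  by (rule zero_mem_sit_set[OF locality])

lemma B_mult: "v \<in> S \<Longrightarrow> x \<in> Oset v \<Longrightarrow> y \<in> B v \<Longrightarrow> x * y \<in> B v"
  by (rule sit_set_mult[OF locality])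

lemma add_bounded:
  assumes v: "v \<in> S"
  shows "add_bounded t v"
proof -
  have "t * (a + b) \<in> Oset v" if "a \<in> Oset v" "b \<in> Oset v" for a b
  proof -
    have "a + b \<in> inverse t *o Oset v"
      using set_plus_intro[OF that] uniform[OF v] by blast
    then show ?thesis
      using mem_elt_set_times_iff[of "inverse t" "a + b"] t_nonzero
      by (simp add: divide_inverse mult.commute)
  qed
  then show ?thesis by (simp add: add_bounded_def)
qed

lemmas O_add = add_boundedD[OF add_bounded]

lemma t_mem: "v \<in> S \<Longrightarrow> t \<in> Oset v"
  using O_add[OF _ O_1 Oset_0[OF locality], of v] by simp

lemma B_add: "v \<in> S \<Longrightarrow> a \<in> B v \<Longrightarrow> b \<in> B v \<Longrightarrow> t * (a + b) \<in> B v"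
  using Mset_add[OF locality add_bounded] O_add by (cases sit) auto

text \<open>Reads avoidance of \<open>t *o Mset v\<close> as a lower bound on the size of
  \<open>x\<close>; (ii) and (iii) are used in this form.\<close>

lemma not_mem_t_Mset:
  assumes v: "v \<in> S" and "x \<notin> t *o Mset v"
  shows "x \<noteq> 0" "t / x \<in> Oset v"
  using assms mem_elt_set_times_iff[OF t_nonzero, of x "Mset v"] zero_mem_Mset[OF locality[OF v]]
  by (auto simp: Mset_iff[OF locality[OF v]])

lemma f_inside:
  assumes v: "v \<in> S" and x: "x \<in> Oset v"
  shows "poly f x \<in> Oset v" "poly f x \<noteq> 0" "t / poly f x \<in> Oset v"
proof -
  show "poly f x \<in> Oset v" using uniform[OF v] x by blast
  have "poly f x \<notin> t *o Mset v" using uniform[OF v] x by blast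
  from not_mem_t_Mset[OF v this] show "poly f x \<noteq> 0" "t / poly f x \<in> Oset v" .
qed

lemma f_outside:
  assumes v: "v \<in> S" and x: "x \<notin> Oset v"
  defines "q \<equiv> poly f x / x ^ degree f"
  shows "x \<noteq> 0" "q \<in> Oset v" "q \<noteq> 0" "t / q \<in> Oset v"
    "(poly f x - lead_coeff f * x ^ degree f) / x ^ (degree f - 1) \<in> Oset v"
proof -
  show x0: "x \<noteq> 0" using x Oset_0[OF locality[OF v]] by auto
  have *: "poly f x \<in> (x ^ degree f) *o (Oset v - t *o Mset v)"
    "poly f x \<in> (lead_coeff f * x ^ degree f) +o ((x ^ (degree f - 1)) *o Oset v)"
    using uniform[OF v] x by blast+
  have "q \<in> Oset v - t *o Mset v"
    using *(1) mem_elt_set_times_iff[of "x ^ degree f" "poly f x"] x0 by (simp add: q_def)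
  then show "q \<in> Oset v" "q \<noteq> 0" "t / q \<in> Oset v"
    using not_mem_t_Mset[OF v, of q] by auto
  obtain a where "a \<in> (x ^ (degree f - 1)) *o Oset v" "poly f x = lead_coeff f * x ^ degree f + a"
    using *(2) by (auto simp: elt_set_plus_def)
  then show "(poly f x - lead_coeff f * x ^ degree f) / x ^ (degree f - 1) \<in> Oset v"
    using mem_elt_set_times_iff[of "x ^ (degree f - 1)" a] x0 by simp
qed

lemma f_nonzero:
  assumes v: "v \<in> S"
  shows "poly f x \<noteq> 0"
  using f_inside(2)[OF v, of x] f_outside(3)[OF v, of x] by auto

text \<open>Outside \<open>Oset v\<close>, (iii) makes the leading coefficient a sum of
  \<open>poly f x / x ^ degree f\<close> and a remainder times \<open>inverse x\<close>, both in
  \<open>Oset v\<close>; adding them costs \<open>t\<close>.\<close>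

lemma lead_coeff_bounded:
  assumes v: "v \<in> S"
  shows "t * lead_coeff f \<in> Oset v"
proof (cases "Oset v = UNIV")
  case False
  then obtain x where x: "x \<notin> Oset v" by blast
  note out = f_outside[OF v x]
  define a where "a = (poly f x - lead_coeff f * x ^ degree f) / x ^ (degree f - 1)"
  have "x ^ degree f = x * x ^ (degree f - 1)"
    using degree_f by (simp flip: power_Suc)
  then have "lead_coeff f = poly f x / x ^ degree f + - (a * inverse x)"
    using out(1) by (simp add: a_def field_simps)
  moreover have "inverse x \<in> Oset v" using O_total[OF v, of x] x by blast
  then have "- (a * inverse x) \<in> Oset v"
    using O_uminus[OF v O_mult[OF v out(5)]] unfolding a_def by blast
  ultimately show ?thesis using O_add[OF v out(2)] by metis
qed simp

text \<open>The precision is \<open>c\<close>; the clause with \<open>t\<close> is a reserve that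
  pays for the factor \<open>inverse t\<close> arising in combinations.\<close>

definition small :: "'a locality \<Rightarrow> 'a \<Rightarrow> 'a \<Rightarrow> bool" where
  "small v c y \<longleftrightarrow> y / t \<in> B v \<and> y / c \<in> B v"

lemma small_mult:
  assumes "v \<in> S" "x \<in> Oset v" "small v c y"
  shows "small v c (x * y)"
  using assms B_mult[OF assms(1,2)] by (simp add: small_def flip: times_divide_eq_right)

lemma small_mem:
  assumes v: "v \<in> S" and y: "small v c y"
  shows "y \<in> Oset v"
  using O_mult[OF v B_subset[OF v] t_mem[OF v], of "y / t"] y t_nonzero by (simp add: small_def)

text \<open>
  Since \<open>degree f \<ge> 2\<close>, the power compensates the factor \<open>inverse t\<close>; this is why
  arbitrarily many elements can be combined below without loss.
\<close>

lemma small_power: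
  assumes v: "v \<in> S" and y: "small v c y"
  shows "small v c (inverse t * y ^ degree f)"
proof -
  have "inverse t * y ^ degree f = (y / t * y ^ (degree f - 2)) * y"
  proof -
    have "degree f = Suc (Suc (degree f - 2))" using degree_f by simp
    then have "y ^ degree f = y * y ^ (degree f - 2) * y" by (metis mult.commute power_Suc)
    then show ?thesis by (simp add: divide_inverse mult_ac)
  qed
  moreover have "y / t * y ^ (degree f - 2) \<in> Oset v"
    using O_mult[OF v B_subset[OF v] O_power[OF v small_mem[OF v y]]] y unfolding small_def by blast
  ultimately show ?thesis using small_mult[OF v _ y] by metis
qed

text \<open>Here \<open>q\<close> is a value of \<open>f\<close>, possibly divided by a power,
  bounded above by 1 and below by \<open>t\<close>. The lower bound brings in
  \<open>inverse t\<close>, which \<open>small_power\<close> absorbs.\<close>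

lemma small_power_mult:
  assumes v: "v \<in> S" and q: "q \<in> Oset v" "q \<noteq> 0" "t / q \<in> Oset v" and y: "y = e ^ degree f * q"
  shows "small v c e \<Longrightarrow> small v c y" "small v c (inverse e) \<Longrightarrow> small v c (inverse y)"
proof -
  assume e: "small v c e"
  have "degree f = Suc (degree f - 1)" using degree_f by simp
  then have "y = (q * e ^ (degree f - 1)) * e" unfolding y by (metis mult.assoc mult.commute power_Suc)
  then show "small v c y"
    using small_mult[OF v O_mult[OF v q(1) O_power[OF v small_mem[OF v e]]] e] by metis
next
  assume e: "small v c (inverse e)"
  have "inverse y = t / q * (inverse t * inverse e ^ degree f)"
    using t_nonzero by (simp add: y power_inverse divide_inverse)
  then show "small v c (inverse y)"
    using small_mult[OF v q(3) small_power[OF v e]] by metis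
qed

text \<open>
  The form \<open>b ^ degree f * poly f (a / b)\<close> is anisotropic uniformly on \<open>S\<close>: up to \<open>t\<close>, its size is
  the \<open>degree f\<close>-th power of the maximum of the sizes of \<open>a\<close> and \<open>b\<close>.
\<close>

lemma combine_two:
  assumes "a \<noteq> 0" "b \<noteq> 0"
  obtains y where "y \<noteq> 0"
    "\<And>v c. v \<in> S \<Longrightarrow> small v c (inverse a) \<or> small v c (inverse b) \<Longrightarrow> small v c (inverse y)"
    "\<And>v c. v \<in> S \<Longrightarrow> small v c a \<Longrightarrow> small v c b \<Longrightarrow> small v c y"
proof (cases "S = {}")
  \<comment> \<open>\<open>f\<close> is known to have no zeros only when \<open>S\<close> has a
    member.\<close>
  case True
  then show ?thesis using that[of 1] by simp
next
  case False
  define y where "y = b ^ degree f * poly f (a / b)"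
  have step: "(small v c (inverse a) \<or> small v c (inverse b) \<longrightarrow> small v c (inverse y)) \<and>
      (small v c a \<longrightarrow> small v c b \<longrightarrow> small v c y)" if v: "v \<in> S" for v c
  proof (cases "a / b \<in> Oset v")
    case True
    note y = small_power_mult[OF v f_inside[OF v True] y_def, of c]
    \<comment> \<open>Here \<open>b\<close> is the larger of the two, so it alone governs
      \<open>y\<close>.\<close>
    have "small v c (inverse b)" if "small v c (inverse a)"
      using small_mult[OF v True that] assms by (simp add: inverse_eq_divide)
    then show ?thesis using y by blast
  next
    case False
    then have ba: "b / a \<in> Oset v" using O_total[OF v, of "a / b"] by simp
    have "y = a ^ degree f * (poly f (a / b) / (a / b) ^ degree f)"
      using assms by (simp add: y_def power_divide)
    note y = small_power_mult[OF v f_outside(2-4)[OF v False] this, of c]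
    have "small v c (inverse a)" if "small v c (inverse b)"
      using small_mult[OF v ba that] assms by (simp add: inverse_eq_divide)
    then show ?thesis using y by blast
  qed
  show ?thesis
  proof (rule that)
    show "y \<noteq> 0" using False f_nonzero assms by (auto simp: y_def)
  qed (use step in blast)+
qed

text \<open>One \<open>y\<close> serves all \<open>v\<close> and \<open>c\<close> at once; this
  matters because different sets carry different precisions.\<close>

lemma combine_finite:
  assumes "finite Y" "Y \<noteq> {}" "0 \<notin> Y"
  shows "\<exists>y. y \<noteq> 0 \<and> (\<forall>v\<in>S. \<forall>c. ((\<exists>a\<in>Y. small v c (inverse a)) \<longrightarrow> small v c (inverse y)) \<and>
      ((\<forall>a\<in>Y. small v c a) \<longrightarrow> small v c y))"
  using assms
proof (induction rule: finite_ne_induct)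
  case (singleton a)
  then show ?case by (intro exI[of _ a]) simp
next
  case (insert a Y)
  have "0 \<notin> Y" "a \<noteq> 0" using insert.prems by auto
  from insert.IH[OF this(1)] obtain b where b: "b \<noteq> 0"
    "\<And>v c a. v \<in> S \<Longrightarrow> a \<in> Y \<Longrightarrow> small v c (inverse a) \<Longrightarrow> small v c (inverse b)"
    "\<And>v c. v \<in> S \<Longrightarrow> \<forall>a\<in>Y. small v c a \<Longrightarrow> small v c b"
    by metis
  obtain y where y: "y \<noteq> 0"
    "\<And>v c. v \<in> S \<Longrightarrow> small v c (inverse a) \<or> small v c (inverse b) \<Longrightarrow> small v c (inverse y)"
    "\<And>v c. v \<in> S \<Longrightarrow> small v c a \<Longrightarrow> small v c b \<Longrightarrow> small v c y"
    using combine_two[OF \<open>a \<noteq> 0\<close> b(1)] by metis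
  show ?case
  proof (intro exI[of _ y] conjI ballI allI impI)
    fix v c assume v: "v \<in> S"
    show "small v c (inverse y)" if "\<exists>d\<in>insert a Y. small v c (inverse d)"
      using that b(2)[OF v] y(2)[OF v] by blast
    show "small v c y" if "\<forall>d\<in>insert a Y. small v c d"
      using that b(3)[OF v] y(3)[OF v] by blast
  qed (rule y(1))
qed

section \<open>From pairs of localities to compact sets\<close>

lemma openin_small: "openin (sit_topology sit) {v \<in> localities. small v c y}"
proof -
  have "{v \<in> localities. small v c y} =
      {v \<in> localities. y / t \<in> B v} \<inter> {v \<in> localities. y / c \<in> B v}"
    unfolding small_def by blast
  then show ?thesis using openin_Int[OF openin_sit_set openin_sit_set] by simp
qed

text \<open>Compactness is used twice: over each \<open>C i\<close> with \<open>w\<close> fixed,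
  then over \<open>T\<close>. Each finite family found is merged by
  \<open>combine_finite\<close>.\<close>

lemma compact_separation:
  assumes I: "finite I" and C: "\<And>i. i \<in> I \<Longrightarrow> C i \<subseteq> S" "\<And>i. i \<in> I \<Longrightarrow> compactin (sit_topology sit) (C i)"
    and T: "T \<subseteq> S" "compactin (sit_topology sit) T"
    and nonempty: "i0 \<in> I" "C i0 \<noteq> {}" "T \<noteq> {}"
    and local: "\<And>i v w. i \<in> I \<Longrightarrow> v \<in> C i \<Longrightarrow> w \<in> T \<Longrightarrow>
      \<exists>y. y \<noteq> 0 \<and> small v (\<gamma> i) y \<and> small w \<delta> (inverse y)"
  shows "\<exists>y. y \<noteq> 0 \<and> (\<forall>i\<in>I. \<forall>v\<in>C i. small v (\<gamma> i) y) \<and> (\<forall>w\<in>T. small w \<delta> (inverse y))"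
proof -
  have pointwise: "\<forall>w\<in>T. \<exists>y. (y \<noteq> 0 \<and> (\<forall>i\<in>I. \<forall>v\<in>C i. small v (\<gamma> i) y)) \<and>
      w \<in> {v \<in> localities. small v \<delta> (inverse y)}"
  proof
    fix w assume w: "w \<in> T"
    have "\<exists>Y. finite Y \<and> (\<forall>y\<in>Y. y \<noteq> 0 \<and> small w \<delta> (inverse y)) \<and>
        (\<forall>v\<in>C i. \<exists>y\<in>Y. small v (\<gamma> i) y)" if i: "i \<in> I" for i
    proof -
      have "\<forall>v\<in>C i. \<exists>y. (y \<noteq> 0 \<and> small w \<delta> (inverse y)) \<and>
          v \<in> {v \<in> localities. small v (\<gamma> i) y}"
      proof
        fix v assume "v \<in> C i"
        then show "\<exists>y. (y \<noteq> 0 \<and> small w \<delta> (inverse y)) \<and> v \<in> {v \<in> localities. small v (\<gamma> i) y}"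
          using local[OF i _ w] locality[OF subsetD[OF C(1)[OF i]]] by auto
      qed
      from compactin_finite_cover[where Q = "\<lambda>y. y \<noteq> 0 \<and> small w \<delta> (inverse y)"
          and U = "\<lambda>y. {v \<in> localities. small v (\<gamma> i) y}", OF C(2)[OF i] openin_small this]
      obtain Y where "finite Y" "\<forall>y\<in>Y. y \<noteq> 0 \<and> small w \<delta> (inverse y)"
        "C i \<subseteq> (\<Union>y\<in>Y. {v \<in> localities. small v (\<gamma> i) y})"
        by (elim exE conjE)
      then show ?thesis by (intro exI[of _ Y]) auto
    qed
    then obtain Y where Y: "\<And>i. i \<in> I \<Longrightarrow> finite (Y i)"
      "\<And>i y. i \<in> I \<Longrightarrow> y \<in> Y i \<Longrightarrow> y \<noteq> 0 \<and> small w \<delta> (inverse y)"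
      "\<And>i v. i \<in> I \<Longrightarrow> v \<in> C i \<Longrightarrow> \<exists>y\<in>Y i. small v (\<gamma> i) y"
      by metis
    \<comment> \<open>A combination is small where all members are, but large where just one is. At
      \<open>v\<close> only one member of the cover is known to be small, so inverses are
      combined.\<close>
    define Z where "Z = inverse ` (\<Union>i\<in>I. Y i)"
    have Z: "finite Z" "0 \<notin> Z" "\<And>a. a \<in> Z \<Longrightarrow> small w \<delta> a"
      using I Y(1,2) by (auto simp: Z_def)
    have Z4: "\<exists>a\<in>Z. small v (\<gamma> i) (inverse a)" if iv: "i \<in> I" "v \<in> C i" for i v
    proof -
      obtain y where "y \<in> Y i" "small v (\<gamma> i) y" using Y(3)[OF iv] by blast
      then show ?thesis using iv(1) by (intro bexI[of _ "inverse y"]) (auto simp: Z_def)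
    qed
    have "Z \<noteq> {}" using Z4[OF nonempty(1)] nonempty(2) by blast
    from combine_finite[OF Z(1) this Z(2)] obtain y where "y \<noteq> 0" and
      y: "\<And>v c. v \<in> S \<Longrightarrow> \<exists>a\<in>Z. small v c (inverse a) \<Longrightarrow> small v c (inverse y)"
        "\<And>v c. v \<in> S \<Longrightarrow> \<forall>a\<in>Z. small v c a \<Longrightarrow> small v c y"
      by metis
    have "small v (\<gamma> i) (inverse y)" if "i \<in> I" "v \<in> C i" for i v
      using y(1)[OF _ Z4[OF that]] C(1) that by blast
    moreover have wS: "w \<in> S" using w T(1) by blast
    then have "small w \<delta> (inverse (inverse y))"
      using y(2) Z(3) by simp
    ultimately show "\<exists>y. (y \<noteq> 0 \<and> (\<forall>i\<in>I. \<forall>v\<in>C i. small v (\<gamma> i) y)) \<and>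
        w \<in> {v \<in> localities. small v \<delta> (inverse y)}"
      using \<open>y \<noteq> 0\<close> locality[OF wS] by (intro exI[of _ "inverse y"]) simp
  qed
  from compactin_finite_cover[where Q = "\<lambda>y. y \<noteq> 0 \<and> (\<forall>i\<in>I. \<forall>v\<in>C i. small v (\<gamma> i) y)"
      and U = "\<lambda>y. {v \<in> localities. small v \<delta> (inverse y)}", OF T(2) openin_small pointwise]
  obtain Y where Y: "finite Y" "\<forall>y\<in>Y. y \<noteq> 0 \<and> (\<forall>i\<in>I. \<forall>v\<in>C i. small v (\<gamma> i) y)"
    "T \<subseteq> (\<Union>y\<in>Y. {v \<in> localities. small v \<delta> (inverse y)})"
    by (elim exE conjE)
  have "Y \<noteq> {}" "0 \<notin> Y" using Y(2,3) nonempty(3) by auto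
  from combine_finite[OF Y(1) this] obtain y where "y \<noteq> 0" and
    y: "\<And>v c. v \<in> S \<Longrightarrow> \<exists>a\<in>Y. small v c (inverse a) \<Longrightarrow> small v c (inverse y)"
      "\<And>v c. v \<in> S \<Longrightarrow> \<forall>a\<in>Y. small v c a \<Longrightarrow> small v c y"
    by metis
  have "small v (\<gamma> i) y" if "i \<in> I" "v \<in> C i" for i v
    using y(2) Y(2) C(1) that by blast
  moreover have "small w \<delta> (inverse y)" if "w \<in> T" for w
    using y(1) Y(3) T(1) that by blast
  ultimately show ?thesis using \<open>y \<noteq> 0\<close> by (intro exI[of _ y]) simp
qed

text \<open>
  Condition (iii) on \<open>f\<close> makes this close to \<open>1\<close> at large arguments; at small ones it is close
  to \<open>0\<close>.
\<close>

definition bump :: "'a \<Rightarrow> 'a" where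
  "bump y = lead_coeff f * y ^ degree f / poly f y"

text \<open>One factor \<open>t\<close> pays for the leading coefficient, the other for dividing by
  \<open>poly f y\<close>.\<close>

lemma bump_mem:
  assumes v: "v \<in> S" and y: "y \<in> Oset v"
  shows "t ^ 2 * bump y \<in> Oset v"
proof -
  have "t ^ 2 * bump y = (t * lead_coeff f) * (t / poly f y) * y ^ degree f"
    by (simp add: bump_def power2_eq_square)
  then show ?thesis
    using O_mult[OF v O_mult[OF v lead_coeff_bounded[OF v] f_inside(3)[OF v y]] O_power[OF v y]]
    by metis
qed

lemma bump_small:
  assumes v: "v \<in> S" and y: "small v c y"
  shows "t ^ 2 * bump y / c \<in> B v"
proof -
  note yO = small_mem[OF v y]
  have "y ^ degree f = y ^ (degree f - 1) * y"
    using degree_f by (simp flip: power_Suc2)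
  then have "t ^ 2 * bump y / c = ((t * lead_coeff f) * (t / poly f y) * y ^ (degree f - 1)) * (y / c)"
    by (simp add: bump_def power2_eq_square)
  moreover have "(t * lead_coeff f) * (t / poly f y) * y ^ (degree f - 1) \<in> Oset v"
    by (intro O_mult[OF v] lead_coeff_bounded[OF v] f_inside(3)[OF v yO] O_power[OF v yO])
  ultimately show ?thesis using B_mult[OF v] y unfolding small_def by metis
qed

text \<open>For \<open>y\<close> outside \<open>Oset w\<close> the numerator of
  \<open>1 - bump y\<close> has order \<open>degree f - 1\<close> by (iii), so the quotient has
  order \<open>inverse y\<close>.\<close>

lemma bump_large:
  assumes w: "w \<in> S" and y0: "y \<noteq> 0" and y: "small w c (inverse y)"
  shows "t ^ 3 * (1 - bump y) / c \<in> B w"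
proof (cases "y \<in> Oset w")
  \<comment> \<open>This happens only for \<open>Sit_O\<close>, with \<open>y\<close> a unit. Then
    \<open>1 / c\<close> is in \<open>Oset w\<close>, and the third factor \<open>t\<close> pays for
    the subtraction.\<close>
  case True
  have yt: "inverse y / t \<in> B w" and yc: "inverse y / c \<in> B w"
    using y by (simp_all add: small_def)
  have "sit = Sit_O"
  proof (cases sit)
    case Sit_m
    then have "t * (inverse y / t) \<in> Mset w"
      using yt Mset_mult[OF locality[OF w] t_mem[OF w], of "inverse y / t"] by simp
    then show ?thesis using True y0 t_nonzero by (simp add: Mset_iff[OF locality[OF w]])
  qed simp
  have "y * (inverse y / c) \<in> Oset w"
    using O_mult[OF w True B_subset[OF w yc]] by blast
  moreover have "y * (inverse y / c) = 1 / c" using y0 by simp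
  ultimately have "1 / c \<in> Oset w" by metis
  moreover have "t * (t ^ 2 + - (t ^ 2 * bump y)) \<in> Oset w"
    using O_add[OF w O_power[OF w t_mem[OF w]] O_uminus[OF w bump_mem[OF w True]]] .
  moreover have "t ^ 3 * (1 - bump y) / c = t * (t ^ 2 + - (t ^ 2 * bump y)) * (1 / c)"
    by (simp add: power3_eq_cube power2_eq_square right_diff_distrib mult.assoc)
  ultimately show ?thesis using O_mult[OF w] \<open>sit = Sit_O\<close> by (metis sit_set.simps(2))
next
  case False
  note out = f_outside[OF w False]
  define a where "a = (poly f y - lead_coeff f * y ^ degree f) / y ^ (degree f - 1)"
  define q where "q = poly f y / y ^ degree f"
  have "y ^ degree f = y ^ (degree f - 1) * y"
    using degree_f by (simp flip: power_Suc2)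
  then have "1 - bump y = a / q * inverse y"
    using y0 f_nonzero[OF w, of y] by (simp add: a_def q_def bump_def field_simps)
  then have "t ^ 3 * (1 - bump y) / c = (t ^ 2 * a * (t / q)) * (inverse y / c)"
    by (simp add: power3_eq_cube power2_eq_square)
  moreover have "t ^ 2 * a * (t / q) \<in> Oset w"
    unfolding a_def q_def by (intro O_mult[OF w] O_power[OF w t_mem[OF w]] out)
  ultimately show ?thesis using B_mult[OF w] y unfolding small_def by metis
qed

text \<open>Of the two balls defining \<open>small\<close>, one contains the other.\<close>

lemma small_of_ball:
  assumes v: "v \<in> S" and c: "c \<noteq> 0"
  shows "\<exists>c'\<in>{t, c}. \<forall>y. y / c' \<in> B v \<longrightarrow> small v c y"
proof (cases "t / c \<in> Oset v")
  case True
  have "small v c y" if "y / t \<in> B v" for y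
    using B_mult[OF v True that] that t_nonzero by (simp add: small_def)
  then show ?thesis by blast
next
  case False
  then have ct: "c / t \<in> Oset v" using O_total[OF v, of "t / c"] by simp
  have "small v c y" if "y / c \<in> B v" for y
    using B_mult[OF v ct that] that c by (simp add: small_def)
  then show ?thesis by blast
qed

lemma local_separation:
  assumes v: "v \<in> S" and w: "w \<in> S" and ind: "independent_at t v w"
    and inc: "sit = Sit_m \<Longrightarrow> incomparable v w" and cd: "c \<noteq> 0" "d \<noteq> 0"
    and R: "\<And>R. valuation_subring R \<Longrightarrow> Oset v \<subseteq> R \<Longrightarrow> Oset w \<subseteq> R \<Longrightarrow> inverse c \<in> R \<and> inverse d \<in> R"
  shows "\<exists>y. y \<noteq> 0 \<and> small v c y \<and> small w d (inverse y)"
proof -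
  obtain c' where c': "c' \<in> {t, c}" "\<And>y. y / c' \<in> B v \<Longrightarrow> small v c y"
    using small_of_ball[OF v cd(1)] by blast
  obtain d' where d': "d' \<in> {t, d}" "\<And>y. y / d' \<in> B w \<Longrightarrow> small w d y"
    using small_of_ball[OF w cd(2)] by blast
  note vw = locality[OF v] locality[OF w] ind add_bounded[OF v] add_bounded[OF w]
  have "inverse c' \<in> R \<and> inverse d' \<in> R"
    if "valuation_subring R" "Oset v \<subseteq> R" "Oset w \<subseteq> R" for R
    using c'(1) d'(1) R[OF that] independent_at_inverse_mem[OF vw that] by blast
  moreover have "c' \<noteq> 0" "d' \<noteq> 0" using c'(1) d'(1) cd t_nonzero by auto
  ultimately obtain y where "y \<noteq> 0" "y / c' \<in> B v" "inverse y / d' \<in> B w"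
    using independent_at_separation[OF vw inc, where c = c' and d = d'] by metis
  then show ?thesis using c'(2) d'(2) by blast
qed

text \<open>Hypothesis (I) appears as membership in all valuation rings above a pair, the form in
  which it meets the product sets.\<close>

lemma approximation:
  fixes C :: "'i \<Rightarrow> 'a locality set" and x z :: "'i \<Rightarrow> 'a"
  assumes "finite I" "\<And>i. i \<in> I \<Longrightarrow> C i \<subseteq> S"
    "\<And>i. i \<in> I \<Longrightarrow> compactin (sit_topology sit) (C i)"
    and "\<And>i. i \<in> I \<Longrightarrow> z i \<noteq> 0"
    and "\<And>i j v w. i \<in> I \<Longrightarrow> j \<in> I \<Longrightarrow> i \<noteq> j \<Longrightarrow> v \<in> C i \<Longrightarrow> w \<in> C j \<Longrightarrow> independent_at t v w"
    and "\<And>i j v w. sit = Sit_m \<Longrightarrow> i \<in> I \<Longrightarrow> j \<in> I \<Longrightarrow> i \<noteq> j \<Longrightarrow> v \<in> C i \<Longrightarrow> w \<in> C j \<Longrightarrow>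
      incomparable v w"
    and "\<And>i j v w R. i \<in> I \<Longrightarrow> j \<in> I \<Longrightarrow> i \<noteq> j \<Longrightarrow> v \<in> C i \<Longrightarrow> w \<in> C j \<Longrightarrow>
      valuation_subring R \<Longrightarrow> Oset v \<subseteq> R \<Longrightarrow> Oset w \<subseteq> R \<Longrightarrow> (x i - x j) / z i \<in> R \<and> z i / z j \<in> R"
  shows "\<exists>y. \<forall>i\<in>I. \<forall>v\<in>C i. (y - x i) / z i \<in> B v"
  using assms
proof (induction I arbitrary: z rule: finite_induct)
  case empty
  show ?case by simp
next
  case (insert j I)
  note C = insert.prems(1) and compact = insert.prems(2) and z = insert.prems(3)
    and ind = insert.prems(4) and inc = insert.prems(5) and ring = insert.prems(6)
  have inverse_t: "inverse t \<in> R"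
    if "i \<in> insert j I" "k \<in> insert j I" "i \<noteq> k" "v \<in> C i" "w \<in> C k"
      "valuation_subring R" "Oset v \<subseteq> R" "Oset w \<subseteq> R" for i k v w R
  proof -
    have vw: "v \<in> S" "w \<in> S" using C that(1,2,4,5) by blast+
    show ?thesis
      by (rule independent_at_inverse_mem[OF locality[OF vw(1)] locality[OF vw(2)]
            ind[OF that(1-5)] add_bounded[OF vw(1)] add_bounded[OF vw(2)] that(6-8)])
  qed
  \<comment> \<open>The precision \<open>t * z i\<close> anticipates the factor \<open>t\<close>
    lost when the correction is added; hence the induction generalizes \<open>z\<close>.\<close>
  have "\<exists>y. \<forall>i\<in>I. \<forall>v\<in>C i. (y - x i) / (t * z i) \<in> B v"
  proof (rule insert.IH)
    show "independent_at t v w"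
      if "i \<in> I" "k \<in> I" "i \<noteq> k" "v \<in> C i" "w \<in> C k" for i k v w
      by (rule ind[OF insertI2 insertI2 that(3-5)]) (rule that(1,2))+
    show "incomparable v w"
      if "sit = Sit_m" "i \<in> I" "k \<in> I" "i \<noteq> k" "v \<in> C i" "w \<in> C k" for i k v w
      by (rule inc[OF that(1) insertI2 insertI2 that(4-6)]) (rule that(2,3))+
  next
    fix i k v w R
    assume *: "i \<in> I" "k \<in> I" "i \<noteq> k" "v \<in> C i" "w \<in> C k"
      "valuation_subring R" "Oset v \<subseteq> R" "Oset w \<subseteq> R"
    have "inverse t * ((x i - x k) / z i) \<in> R"
      using inverse_t[of i k v w R] ring[of i k v w R] * valuation_subring_mult by blast
    moreover have "z i / z k \<in> R" using ring[of i k v w R] * by blast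
    moreover have "(x i - x k) / (t * z i) = inverse t * ((x i - x k) / z i)"
      "t * z i / (t * z k) = z i / z k"
      using t_nonzero by (simp_all add: field_simps)
    ultimately show "(x i - x k) / (t * z i) \<in> R \<and> t * z i / (t * z k) \<in> R"
      by metis
  qed (use C compact z t_nonzero in auto)
  then obtain x' where x': "\<And>i v. i \<in> I \<Longrightarrow> v \<in> C i \<Longrightarrow> (x' - x i) / (t * z i) \<in> B v"
    by blast
  have x'_I: "(x' - x i) / z i \<in> B v" if "i \<in> I" "v \<in> C i" for i v
  proof -
    have "v \<in> S" using C that by blast
    from B_mult[OF this t_mem[OF this] x'[OF that]] show ?thesis using t_nonzero by simp
  qed
  define \<Delta> where "\<Delta> = x j - x'"
  \<comment> \<open>Degenerate cases first: \<open>compact_separation\<close> needs nonempty sets,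
    and the precisions below divide by \<open>\<Delta>\<close>.\<close>
  consider "C j = {} \<or> \<Delta> = 0" | "\<forall>i\<in>I. C i = {}" | i0 where "C j \<noteq> {}" "\<Delta> \<noteq> 0" "i0 \<in> I" "C i0 \<noteq> {}"
    by blast
  then show ?case
  proof cases
    case 1
    then have "(x' - x j) / z j \<in> B v" if "v \<in> C j" for v
      using 1 that B_0[of v] C[of j] by (auto simp: \<Delta>_def)
    then show ?thesis using x'_I by (intro exI[of _ x']) auto
  next
    case 2
    then show ?thesis
      using B_0 C[of j] by (intro exI[of _ "x j"]) auto
  next
    case 3
    \<comment> \<open>The cube fits both uses: \<open>t ^ 2 * e / \<gamma> i\<close> equals
      \<open>e * \<Delta> / (t * z i)\<close>, and \<open>t ^ 3 * (1 - e) / \<gamma> j\<close>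
      equals \<open>(1 - e) * \<Delta> / z j\<close>.\<close>
    define \<gamma> where "\<gamma> i = t ^ 3 * z i / \<Delta>" for i
    have local: "\<exists>y. y \<noteq> 0 \<and> small v (\<gamma> i) y \<and> small w (\<gamma> j) (inverse y)"
      if i: "i \<in> I" "v \<in> C i" and w: "w \<in> C j" for i v w
    proof (rule local_separation)
      have ij: "i \<in> insert j I" "j \<in> insert j I" "i \<noteq> j" using i insert.hyps by auto
      show v: "v \<in> S" and "w \<in> S" using C[OF ij(1)] C[OF ij(2)] i w by blast+
      show "independent_at t v w" by (rule ind[OF ij i(2) w])
      show "incomparable v w" if "sit = Sit_m" by (rule inc[OF that ij i(2) w])
      show "\<gamma> i \<noteq> 0" "\<gamma> j \<noteq> 0" using t_nonzero 3(2) z ij by (auto simp: \<gamma>_def)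
      fix R assume R: "valuation_subring R" "Oset v \<subseteq> R" "Oset w \<subseteq> R"
      have "- ((x i - x j) / z i) \<in> R"
        using valuation_subring_uminus[OF R(1)] ring[OF ij i(2) w R] by blast
      moreover have "(x' - x i) / z i \<in> R"
        using B_subset[OF v x'_I[OF i]] R(2) by blast
      ultimately have "- ((x i - x j) / z i) - (x' - x i) / z i \<in> R"
        by (rule valuation_subring_diff[OF R(1)])
      moreover have "- ((x i - x j) / z i) - (x' - x i) / z i = \<Delta> / z i"
        using z[OF ij(1)] by (simp add: \<Delta>_def field_simps)
      ultimately have i': "\<Delta> / z i \<in> R" by metis
      have "\<Delta> / z i * (z i / z j) \<in> R"
        using valuation_subring_mult[OF R(1) i'] ring[OF ij i(2) w R] by blast
      then have j': "\<Delta> / z j \<in> R" using z[OF ij(1)] by simp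
      have "inverse t * inverse t * inverse t \<in> R"
        using inverse_t[OF ij i(2) w R] by (intro valuation_subring_mult[OF R(1)])
      from valuation_subring_mult[OF R(1) this i'] valuation_subring_mult[OF R(1) this j']
      show "inverse (\<gamma> i) \<in> R \<and> inverse (\<gamma> j) \<in> R"
        by (simp add: \<gamma>_def divide_inverse power3_eq_cube mult_ac)
    qed
    have CI: "C i \<subseteq> S" "compactin (sit_topology sit) (C i)" if "i \<in> I" for i
      using C compact that by auto
    have Cj: "C j \<subseteq> S" "compactin (sit_topology sit) (C j)" using C compact by auto
    have "\<exists>y. y \<noteq> 0 \<and> (\<forall>i\<in>I. \<forall>v\<in>C i. small v (\<gamma> i) y) \<and>
        (\<forall>w\<in>C j. small w (\<gamma> j) (inverse y))"
      by (rule compact_separation) (fact insert.hyps(1) CI Cj 3(3,4,1) local)+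
    then obtain y where y: "y \<noteq> 0" "\<And>i v. i \<in> I \<Longrightarrow> v \<in> C i \<Longrightarrow> small v (\<gamma> i) y"
      "\<And>w. w \<in> C j \<Longrightarrow> small w (\<gamma> j) (inverse y)"
      by metis
    define e where "e = bump y"
    have "(x' + e * \<Delta> - x i) / z i \<in> B v" if i: "i \<in> I" "v \<in> C i" for i v
    proof -
      have v: "v \<in> S" using CI i by blast
      have "t ^ 2 * e / \<gamma> i = e * \<Delta> / (t * z i)"
        using t_nonzero 3(2) z i by (simp add: \<gamma>_def power3_eq_cube power2_eq_square field_simps)
      then have "e * \<Delta> / (t * z i) \<in> B v"
        using bump_small[OF v y(2)[OF i]] by (simp add: e_def)
      from B_add[OF v x'[OF i] this]
      have "t * ((x' - x i) / (t * z i) + e * \<Delta> / (t * z i)) \<in> B v" .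
      moreover have "t * ((x' - x i) / (t * z i) + e * \<Delta> / (t * z i)) = (x' + e * \<Delta> - x i) / z i"
        using t_nonzero z i by (simp add: field_simps)
      ultimately show ?thesis by metis
    qed
    moreover have "(x' + e * \<Delta> - x j) / z j \<in> B w" if w: "w \<in> C j" for w
    proof -
      have wS: "w \<in> S" using Cj w by blast
      have "t ^ 3 * (1 - e) / \<gamma> j \<in> B w"
        using bump_large[OF wS y(1) y(3)[OF w]] by (simp add: e_def)
      from B_mult[OF wS Oset_minus_1[OF locality[OF wS]] this]
      have "- 1 * (t ^ 3 * (1 - e) / \<gamma> j) \<in> B w" .
      moreover have "- 1 * (t ^ 3 * (1 - e) / \<gamma> j) = (x' + e * \<Delta> - x j) / z j"
        using t_nonzero 3(2) z by (simp add: \<gamma>_def \<Delta>_def field_simps)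
      ultimately show ?thesis by metis
    qed
    ultimately show ?thesis by (intro exI[of _ "x' + e * \<Delta>"]) auto
  qed
qed

end

theorem theorem4p6:
  fixes sit :: situation
    and n :: nat
    and S :: "nat \<Rightarrow> 'a::field locality set"
    and t :: 'a
    and x z :: "nat \<Rightarrow> 'a"
  assumes "\<And>i. i \<in> {1..n} \<Longrightarrow> S i \<subseteq> localities"
    and "t \<noteq> 0"
    and "\<And>i. i \<in> {1..n} \<Longrightarrow> z i \<noteq> 0"
    and "uniformity_assumption (\<Union>i\<in>{1..n}. S i) t"
    and "\<And>i. i \<in> {1..n} \<Longrightarrow> compactin (sit_topology sit) (S i)"
    and "\<And>i j (w :: ('a, 'a set) valuation).
           i \<in> {1..n} \<Longrightarrow> j \<in> {1..n} \<Longrightarrow> krull_valuation w \<Longrightarrow>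
           \<exists>v\<in>S i. refines v (locality_of_val w) \<Longrightarrow>
           \<exists>v\<in>S j. refines v (locality_of_val w) \<Longrightarrow>
           val_le w (z i) (x i - x j) \<and> val w (z i) = val w (z j)"
    and "\<And>i j v w. i \<in> {1..n} \<Longrightarrow> j \<in> {1..n} \<Longrightarrow> i \<noteq> j \<Longrightarrow>
           v \<in> S i \<Longrightarrow> w \<in> S j \<Longrightarrow> independent_at t v w"
    and "\<And>i j v w. sit = Sit_m \<Longrightarrow> i \<in> {1..n} \<Longrightarrow> j \<in> {1..n} \<Longrightarrow> i \<noteq> j \<Longrightarrow>
           v \<in> S i \<Longrightarrow> w \<in> S j \<Longrightarrow> incomparable v w"
  shows "\<exists>y. \<forall>i\<in>{1..n}. \<forall>v\<in>S i. y - x i \<in> z i *o sit_set sit v"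
proof -
  obtain f :: "'a poly" where f: "uniform_localities (\<Union>i\<in>{1..n}. S i) t f"
    using assms(1,2,4) unfolding uniformity_assumption_def uniform_localities_def by blast
  interpret uniform_localities "\<Union>i\<in>{1..n}. S i" t f sit by (rule f)
  have "\<exists>y. \<forall>i\<in>{1..n}. \<forall>v\<in>S i. (y - x i) / z i \<in> sit_set sit v"
  proof (rule approximation)
    fix i j v w R
    assume ij: "i \<in> {1..n}" "j \<in> {1..n}" "v \<in> S i" "w \<in> S j"
      and R: "valuation_subring R" "Oset v \<subseteq> R" "Oset w \<subseteq> R"
    \<comment> \<open>The hypothesis speaks of valuations, so \<open>R\<close> is turned into one
      whose order is divisibility in \<open>R\<close>.\<close>
    obtain u :: "('a, 'a set) valuation" where u: "krull_valuation u"
      "\<And>x y. val_le u x y \<longleftrightarrow> y = 0 \<or> x \<noteq> 0 \<and> y / x \<in> R"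
      using valuation_subring_obtains_valuation[OF R(1)] by blast
    have "Oset (locality_of_val u) = R"
      using valuation_subring_0[OF R(1)] by (auto simp: locality_of_val_le[OF u(1)] u(2))
    then have "refines v (locality_of_val u)" "refines w (locality_of_val u)"
      using R by (simp_all add: refines_def)
    then have "val_le u (z i) (x i - x j)" "val u (z i) = val u (z j)"
      using assms(6)[OF ij(1,2) u(1)] ij(3,4) by blast+
    then have "val_le u (z i) (x i - x j)" "val_le u (z j) (z i)"
      using val_eq_iff[OF u(1)] by blast+
    then show "(x i - x j) / z i \<in> R \<and> z i / z j \<in> R"
      using assms(3) ij(1,2) valuation_subring_0[OF R(1)] by (auto simp: u(2))
  qed (use assms(3,5,7,8) in auto)
  then show ?thesis
    using assms(3) by (simp add: mem_elt_set_times_iff)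
qed

end
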